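(* Let $M$ be the Lie group $K=Gl(2,\mathbb{R})$ with the $K$-invariant conformal class (of signature $(1,3)$) determined at the identity by $\alpha_{-1}^*\nu$, where $$\alpha_{-1}\left(\left[\begin{smallmatrix}\frac1{12}x_4+2x_1&\frac{\sqrt3}{6}(3x_2-x_3)\\ \frac{\sqrt3}{6}(3x_2+x_3)&\frac7{12}x_4+2x_1\end{smallmatrix}\right]\right)=(x_1,x_2,x_3,x_4)^t\in\mathbb{R}^4 .$$ Then the center of $\mathfrak{gl}(2,\mathbb{R})$ is generated by a normal conformal Killing field, and $Gl(2,\mathbb{R})/\mathbb{R}$ carries an $Sl(2,\mathbb{R})$-invariant CR geometry with CR-distribution generated by the $x_2,x_3$-entries of $\mathfrak{gl}(2,\mathbb{R})$ and complex structure identifying it with $x_2+ix_3$.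
   Context: $\nu=\left[\begin{smallmatrix}0&0&0&1\\0&1&0&0\\0&0&1&0\\1&0&0&0\end{smallmatrix}\right]$ on $\mathbb{R}^4$; thus the metric at the identity is $2x_1x_4+x_2^2+x_3^2$, extended by left translations of $K=Gl(2,\mathbb{R})$ on itself. Elements of $\mathfrak{k}=\mathfrak{gl}(2,\mathbb{R})$ act as conformal Killing fields generating left translations. $\mathbb{R}$ denotes the one-parameter central subgroup generated by the center of $\mathfrak{gl}(2,\mathbb{R})$ (the $x_1$-direction), and the CR-distribution and its complex structure on the $3$-dimensional quotient are the invariant ones induced at the base point by the $x_2,x_3$-directions. A conformal Killing field is normal if its canonical prolongation to a section of the adjoint tractor bundle (with fibre $\mathfrak{so}(2,4)$) is parallel for the tractor connection induced by the normal conformal Cartan connection. *)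

theory Defs
  imports "HOL-Analysis.Analysis"
begin

section \<open>Smooth maps on open subsets of Euclidean spaces\<close>

primrec Ck_on :: "nat \<Rightarrow> 'a::euclidean_space set \<Rightarrow> ('a \<Rightarrow> 'b::real_normed_vector) \<Rightarrow> bool" where
  "Ck_on 0 S f \<longleftrightarrow> continuous_on S f"
| "Ck_on (Suc k) S f \<longleftrightarrow>
     f differentiable_on S \<and> (\<forall>v. Ck_on k S (\<lambda>x. frechet_derivative f (at x) v))"

definition smooth_on :: "'a::euclidean_space set \<Rightarrow> ('a \<Rightarrow> 'b::real_normed_vector) \<Rightarrow> bool" where
  "smooth_on S f \<longleftrightarrow> (\<forall>k. Ck_on k S f)"


section \<open>Conformal classes and conformal Killing fields\<close>

text \<open>The manifold is an open subset \<open>M\<close> of a Euclidean space \<open>'a\<close>, all of whose tangent spaces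
  are identified with \<open>'a\<close>; a metric is a map from points to bilinear forms.\<close>

type_synonym 'a metric = "'a \<Rightarrow> 'a \<Rightarrow> 'a \<Rightarrow> real"

definition conformal_class :: "'a::euclidean_space set \<Rightarrow> 'a metric \<Rightarrow> 'a metric set" where
  "conformal_class M g = {h. \<exists>f. smooth_on M f \<and> (\<forall>x\<in>M. f x > 0) \<and>
     (\<forall>x\<in>M. \<forall>v w. h x v w = f x * g x v w)}"

definition lie_derivative_metric :: "('a::euclidean_space \<Rightarrow> 'a) \<Rightarrow> 'a metric \<Rightarrow> 'a metric" where
  "lie_derivative_metric \<xi> h = (\<lambda>x v w.
     frechet_derivative (\<lambda>y. h y v w) (at x) (\<xi> x)
     + h x (frechet_derivative \<xi> (at x) v) w
     + h x v (frechet_derivative \<xi> (at x) w))"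

definition conformal_Killing ::
  "'a::euclidean_space set \<Rightarrow> 'a metric set \<Rightarrow> ('a \<Rightarrow> 'a) \<Rightarrow> bool" where
  "conformal_Killing M \<C> \<xi> \<longleftrightarrow> smooth_on M \<xi> \<and>
     (\<forall>h\<in>\<C>. \<exists>f. \<forall>x\<in>M. \<forall>v w. lie_derivative_metric \<xi> h x v w = f x * h x v w)"


section \<open>The Lie algebra so(2,4) and its conformal grading\<close>

definition mat_bracket :: "real^'n^'n \<Rightarrow> real^'n^'n \<Rightarrow> real^'n^'n" where
  "mat_bracket X Y = X ** Y - Y ** X"

definition \<nu> :: "real^4^4" where
  "\<nu> = vector [vector [0,0,0,1],
               vector [0,1,0,0],
               vector [0,0,1,0],
               vector [1,0,0,0]]"

definition \<nu>_form :: "real^4 \<Rightarrow> real^4 \<Rightarrow> real" where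
  "\<nu>_form x y = x \<bullet> (\<nu> *v y)"

text \<open>The form is \<open>2 y\<^sub>1 y\<^sub>6\<close> plus \<open>\<nu>\<close> on the coordinates 2 to 5, so the stabilizer of the null
  line through the first basis vector is the parabolic subgroup \<open>P\<close> of conformal geometry.\<close>

definition tractor_form :: "real^6^6" where
  "tractor_form = vector [vector [0,0,0,0,0,1],
                          vector [0,0,0,0,1,0],
                          vector [0,0,1,0,0,0],
                          vector [0,0,0,1,0,0],
                          vector [0,1,0,0,0,0],
                          vector [1,0,0,0,0,0]]"

definition so24 :: "(real^6^6) set" where
  "so24 = {X. transpose X ** tractor_form + tractor_form ** X = 0}"

text \<open>\<open>neg_part\<close> is the projection of so(2,4) onto its quotient \<open>\<real>\<^sup>4\<close> by the Lie algebra of \<open>P\<close>;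
  \<open>pos_elem\<close> parametrizes the nilradical of that Lie algebra.  If \<open>X \<in> so24\<close> has
  \<open>neg_part X = x\<close>, then \<open>trace (pos_elem z ** X) = 2 * (z \<bullet> x)\<close>; so, up to a common factor,
  the \<open>pos_elem (axis i 1)\<close> form the basis dual to \<open>axis i 1\<close> under the Killing form.\<close>

definition neg_part :: "real^6^6 \<Rightarrow> real^4" where
  "neg_part X = vector [X$2$1, X$3$1, X$4$1, X$5$1]"

definition pos_elem :: "real^4 \<Rightarrow> real^6^6" where
  "pos_elem z = vector [vector [0, z$1, z$2, z$3, z$4, 0],
                        vector [0, 0, 0, 0, 0, - z$4],
                        vector [0, 0, 0, 0, 0, - z$2],
                        vector [0, 0, 0, 0, 0, - z$3],
                        vector [0, 0, 0, 0, 0, - z$1],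
                        vector [0, 0, 0, 0, 0, 0]]"


section \<open>Normal conformal Cartan connections and normal conformal Killing fields\<close>

text \<open>A Cartan connection on the trivial bundle \<open>M \<times> P\<close> is determined by its pullback along the
  section \<open>x \<mapsto> (x, e)\<close>, a so(2,4)-valued one-form \<open>\<omega>\<close> on \<open>M\<close> whose projection \<open>neg_part \<circ> \<omega>\<close> is a
  coframe.  The same section identifies sections of the adjoint tractor bundle with functions
  from \<open>M\<close> to so(2,4).\<close>

type_synonym 'a gauge_form = "'a \<Rightarrow> 'a \<Rightarrow> real^6^6"

definition soldering :: "'a gauge_form \<Rightarrow> 'a \<Rightarrow> 'a \<Rightarrow> real^4" where
  "soldering \<omega> x v = neg_part (\<omega> x v)"

definition curvature :: "'a::euclidean_space gauge_form \<Rightarrow> 'a \<Rightarrow> 'a \<Rightarrow> 'a \<Rightarrow> real^6^6" where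
  "curvature \<omega> x v w =
     frechet_derivative (\<lambda>y. \<omega> y w) (at x) v - frechet_derivative (\<lambda>y. \<omega> y v) (at x) w
     + mat_bracket (\<omega> x v) (\<omega> x w)"

text \<open>The last condition is the vanishing of the Kostant codifferential
  \<open>(\<partial>\<^sup>*\<kappa>)(X) = 2 \<Sum>\<^sub>i [Z\<^sub>i, \<kappa>(X, X\<^sub>i)]\<close> of the curvature function.  Normality and the conformal
  class determine the connection up to isomorphism (that is, up to a gauge transformation of
  \<open>\<omega>\<close>).\<close>

definition normal_conformal_Cartan_connection ::
  "'a::euclidean_space set \<Rightarrow> 'a metric set \<Rightarrow> 'a gauge_form \<Rightarrow> bool" where
  "normal_conformal_Cartan_connection M \<C> \<omega> \<longleftrightarrow>
     (\<forall>x\<in>M. linear (\<omega> x) \<and> range (\<omega> x) \<subseteq> so24 \<and> bij (soldering \<omega> x)) \<and>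
     (\<forall>v. smooth_on M (\<lambda>x. \<omega> x v)) \<and>
     (\<lambda>x v w. \<nu>_form (soldering \<omega> x v) (soldering \<omega> x w)) \<in> \<C> \<and>
     (\<forall>x\<in>M. \<forall>v. (\<Sum>i\<in>UNIV. mat_bracket (pos_elem (axis i 1))
                    (curvature \<omega> x v (inv (soldering \<omega> x) (axis i 1)))) = 0)"

definition tractor_connection ::
  "'a::euclidean_space gauge_form \<Rightarrow> ('a \<Rightarrow> real^6^6) \<Rightarrow> 'a \<Rightarrow> 'a \<Rightarrow> real^6^6" where
  "tractor_connection \<omega> s x v = frechet_derivative s (at x) v + mat_bracket (\<omega> x v) (s x)"

text \<open>A conformal Killing field \<open>\<xi>\<close> has a unique \<open>P\<close>-invariant lift \<open>\<eta>\<close> to the Cartan bundle that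
  preserves the Cartan connection, and its canonical prolongation is the section \<open>s\<close> given by the
  value of the Cartan connection on \<open>\<eta>\<close>.  Pulled back to \<open>M\<close>, the vanishing of the Lie derivative
  of the Cartan connection along \<open>\<eta>\<close> is the last equation below.\<close>

definition canonical_prolongation ::
  "'a::euclidean_space set \<Rightarrow> 'a gauge_form \<Rightarrow> ('a \<Rightarrow> 'a) \<Rightarrow> ('a \<Rightarrow> real^6^6) \<Rightarrow> bool" where
  "canonical_prolongation M \<omega> \<xi> s \<longleftrightarrow>
     smooth_on M s \<and>
     (\<forall>x\<in>M. s x \<in> so24 \<and> neg_part (s x) = soldering \<omega> x (\<xi> x) \<and>
        (\<forall>v. tractor_connection \<omega> s x v + curvature \<omega> x (\<xi> x) v = 0))"

definition normal_conformal_Killing ::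
  "'a::euclidean_space set \<Rightarrow> 'a metric set \<Rightarrow> ('a \<Rightarrow> 'a) \<Rightarrow> bool" where
  "normal_conformal_Killing M \<C> \<xi> \<longleftrightarrow> conformal_Killing M \<C> \<xi> \<and>
     (\<exists>\<omega> s. normal_conformal_Cartan_connection M \<C> \<omega> \<and> canonical_prolongation M \<omega> \<xi> s \<and>
        (\<forall>x\<in>M. \<forall>v. tractor_connection \<omega> s x v = 0))"


section \<open>Gl(2,R), its Lie algebra and the left-invariant conformal class\<close>

type_synonym gl2 = "real^2^2"

definition GL2 :: "gl2 set" where
  "GL2 = {A. invertible A}"

definition SL2 :: "gl2 set" where
  "SL2 = {A. det A = 1}"

definition mexp :: "gl2 \<Rightarrow> gl2" where
  "mexp X = (\<Sum>k. (1 / fact k) *\<^sub>R (((**) X) ^^ k) (mat 1))"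

definition gl2_center :: "gl2 set" where
  "gl2_center = {Z. \<forall>Y. mat_bracket Z Y = 0}"

definition left_translation_field :: "gl2 \<Rightarrow> gl2 \<Rightarrow> gl2" where
  "left_translation_field Z A = vector_derivative (\<lambda>t. mexp (t *\<^sub>R Z) ** A) (at 0)"

definition gl2_of :: "real^4 \<Rightarrow> gl2" where
  "gl2_of x = vector [vector [x$4 / 12 + 2 * x$1, sqrt 3 / 6 * (3 * x$2 - x$3)],
                      vector [sqrt 3 / 6 * (3 * x$2 + x$3), 7 / 12 * x$4 + 2 * x$1]]"

definition \<alpha>_minus1 :: "gl2 \<Rightarrow> real^4" where
  "\<alpha>_minus1 = inv gl2_of"

definition left_invariant_metric :: "gl2 metric" where
  "left_invariant_metric A V W =
     \<nu>_form (\<alpha>_minus1 (matrix_inv A ** V)) (\<alpha>_minus1 (matrix_inv A ** W))"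


section \<open>Three-dimensional CR geometries\<close>

text \<open>A manifold is given here by its set of points \<open>X\<close>, its smooth functions \<open>C\<close> (only their
  values on \<open>X\<close> matter) and its tangent spaces \<open>T q\<close>; tangent vectors are derivations of \<open>C\<close>,
  extended by 0 to functions outside \<open>C\<close>.\<close>

type_synonym 'q tvec = "('q \<Rightarrow> real) \<Rightarrow> real"

definition has_dim :: "nat \<Rightarrow> 'q tvec set \<Rightarrow> bool" where
  "has_dim n V \<longleftrightarrow> (\<exists>b :: nat \<Rightarrow> 'q tvec.
     V = range (\<lambda>c :: nat \<Rightarrow> real. \<lambda>f. \<Sum>i<n. c i * b i f) \<and>
     (\<forall>c :: nat \<Rightarrow> real. (\<forall>f. (\<Sum>i<n. c i * b i f) = 0) \<longrightarrow> (\<forall>i<n. c i = 0)))"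

definition smooth_sections ::
  "'q set \<Rightarrow> ('q \<Rightarrow> real) set \<Rightarrow> ('q \<Rightarrow> 'q tvec set) \<Rightarrow> ('q \<Rightarrow> 'q tvec) set" where
  "smooth_sections X C D = {V. (\<forall>q\<in>X. V q \<in> D q) \<and> (\<forall>f\<in>C. (\<lambda>q. V q f) \<in> C)}"

definition field_bracket ::
  "('q \<Rightarrow> real) set \<Rightarrow> ('q \<Rightarrow> 'q tvec) \<Rightarrow> ('q \<Rightarrow> 'q tvec) \<Rightarrow> 'q \<Rightarrow> 'q tvec" where
  "field_bracket C V W q =
     (\<lambda>f. if f \<in> C then V q (\<lambda>p. W p f) - W q (\<lambda>p. V p f) else 0)"

text \<open>The conditions say in turn: \<open>D\<close> is a smooth distribution of rank 2; \<open>J\<close> is a smooth complex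
  structure on it; the Levi bracket \<open>D \<times> D \<rightarrow> T/D\<close> is nondegenerate; and \<open>(D, J)\<close> is integrable.\<close>

definition CR_geometry3 ::
  "'q set \<Rightarrow> ('q \<Rightarrow> real) set \<Rightarrow> ('q \<Rightarrow> 'q tvec set) \<Rightarrow>
   ('q \<Rightarrow> 'q tvec set) \<Rightarrow> ('q \<Rightarrow> 'q tvec \<Rightarrow> 'q tvec) \<Rightarrow> bool" where
  "CR_geometry3 X C T D J \<longleftrightarrow>
     (\<forall>q\<in>X. has_dim 3 (T q) \<and> has_dim 2 (D q) \<and> D q \<subseteq> T q \<and>
        (\<forall>u\<in>D q. \<exists>V\<in>smooth_sections X C D. V q = u)) \<and>
     (\<forall>q\<in>X. \<forall>u\<in>D q. J q u \<in> D q \<and> J q (J q u) = (\<lambda>f. - u f) \<and>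
        (\<forall>w\<in>D q. \<forall>a b. J q (\<lambda>f. a * u f + b * w f) = (\<lambda>f. a * J q u f + b * J q w f))) \<and>
     (\<forall>V\<in>smooth_sections X C D. (\<lambda>q. J q (V q)) \<in> smooth_sections X C D) \<and>
     (\<forall>V\<in>smooth_sections X C D. \<forall>q\<in>X. V q \<noteq> (\<lambda>f. 0) \<longrightarrow>
        (\<exists>W\<in>smooth_sections X C D. field_bracket C V W q \<notin> D q)) \<and>
     (\<forall>V\<in>smooth_sections X C D. \<forall>W\<in>smooth_sections X C D. \<forall>q\<in>X.
        let JV = (\<lambda>p. J p (V p)); JW = (\<lambda>p. J p (W p));
            U = (\<lambda>f. field_bracket C V W q f - field_bracket C JV JW q f)
        in U \<in> D q \<and> J q U = (\<lambda>f. field_bracket C JV W q f + field_bracket C V JW q f))"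

definition pushforward :: "('q \<Rightarrow> 'q) \<Rightarrow> 'q tvec \<Rightarrow> 'q tvec" where
  "pushforward \<phi> v = (\<lambda>f. v (\<lambda>p. f (\<phi> p)))"

definition CR_invariant ::
  "'q set \<Rightarrow> ('q \<Rightarrow> 'q tvec set) \<Rightarrow> ('q \<Rightarrow> 'q tvec \<Rightarrow> 'q tvec) \<Rightarrow> 'h set \<Rightarrow> ('h \<Rightarrow> 'q \<Rightarrow> 'q) \<Rightarrow> bool"
  where
  "CR_invariant X D J H act \<longleftrightarrow> (\<forall>h\<in>H. \<forall>q\<in>X.
     act h q \<in> X \<and> D (act h q) = pushforward (act h) ` D q \<and>
     (\<forall>u\<in>D q. J (act h q) (pushforward (act h) u) = pushforward (act h) (J q u)))"


section \<open>The quotient Gl(2,R)/R\<close>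

definition central_R :: "gl2 set" where
  "central_R = mexp ` gl2_center"

definition coset_proj :: "gl2 \<Rightarrow> gl2 set" where
  "coset_proj A = (\<lambda>r. A ** r) ` central_R"

definition quot :: "gl2 set set" where
  "quot = coset_proj ` GL2"

definition quot_smooth :: "(gl2 set \<Rightarrow> real) set" where
  "quot_smooth = {f. smooth_on GL2 (\<lambda>A. f (coset_proj A))}"

definition dproj :: "gl2 \<Rightarrow> gl2 \<Rightarrow> gl2 set tvec" where
  "dproj A V = (\<lambda>f. if f \<in> quot_smooth
     then frechet_derivative (\<lambda>B. f (coset_proj B)) (at A) V else 0)"

text \<open>As the projection is a submersion, the tangent spaces of the quotient are the images of its
  differential.\<close>

definition quot_tangent :: "gl2 set \<Rightarrow> gl2 set tvec set" where
  "quot_tangent q = {dproj A V | A V. A \<in> GL2 \<and> coset_proj A = q}"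

definition quot_act :: "gl2 \<Rightarrow> gl2 set \<Rightarrow> gl2 set" where
  "quot_act h q = (\<lambda>A. h ** A) ` q"

text \<open>The image in the quotient of the left-invariant vector field given by the element of the Lie
  algebra with \<open>x\<^sub>1 = x\<^sub>4 = 0\<close> and \<open>x\<^sub>2 + i x\<^sub>3 = z\<close>, evaluated at the coset of \<open>A\<close>.\<close>

definition CR_vector :: "gl2 \<Rightarrow> complex \<Rightarrow> gl2 set tvec" where
  "CR_vector A z = dproj A (A ** gl2_of (vector [0, Re z, Im z, 0]))"

end

theory Submission
  imports Defs
begin

text \<open>The normal conformal Cartan connection is left-invariant, hence given by a linear map from
  \<open>gl(2,\<real>)\<close> to \<open>so(2,4)\<close>, which is determined explicitly by requiring the torsion and the Ricci-type
  trace of its curvature to vanish.  The center is sent to an element that commutes with the whole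
  image, so the corresponding constant section is parallel, and it is the prolongation of the
  central Killing field because the curvature annihilates the \<open>x\<^sub>1\<close>-direction.

  On the quotient, a vector of \<open>gl(2,\<real>)\<close> induces a left-invariant field; the fields of the \<open>x\<^sub>2\<close>- and
  \<open>x\<^sub>3\<close>-directions are a global frame, and their bracket has a nonzero \<open>x\<^sub>4\<close>-component.  This is
  contact, and integrability holds in dimension three because the Levi bracket of any \<open>V\<close>, \<open>W\<close>
  agrees with that of \<open>J V\<close>, \<open>J W\<close>.\<close>

section \<open>Calculus of smooth maps\<close>

text \<open>Behind the matrices lies the picture of a Fefferman space. The element
  \<open>tractor_of (axis 1 1)\<close> is skew for the tractor form and squares to minus the
  identity, so it is a complex structure on the standard tractor space R^6, and whatever commutes
  with it in so(2,4) lies in a copy of u(1,2). It sends the x2-direction to the x3-direction, which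
  is the origin of the complex coordinate x2 + i x3. Left translation by scalars is also right
  translation, so the central field A is left-invariant and becomes constant in the left-invariant
  frame. The quotient is a set of cosets without charts. A function on it is treated as a function
  on the open set \<open>GL2\<close> constant on cosets, a tangent vector as a derivation. The price
  is that a smooth section of the distribution has no visible coefficients: they have to be
  recovered, smoothly in the point, from its values on a few globally defined functions. Vector
  fields and their brackets then reduce to calculus on \<open>GL2\<close>, where the only analytic
  fact beyond the product rule is the symmetry of second derivatives.\<close>

lemma has_derivative_frechet_derivative:
  assumes "open S" "f differentiable_on S" "x \<in> S"
  shows "(f has_derivative frechet_derivative f (at x)) (at x)"
  using assms by (metis at_within_open differentiable_on_def frechet_derivative_works)

lemma frechet_derivative_eq:
  "(f has_derivative f') (at x) \<Longrightarrow> frechet_derivative f (at x) = f'"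
  by (rule frechet_derivative_at[symmetric])

text \<open>\<open>frechet_derivative\<close> is a choice among the derivatives, and both functions
  offer the same candidates; so the equality also covers points where neither function is
  differentiable.\<close>

lemma frechet_derivative_cong:
  assumes "open S" "x \<in> S" "\<And>y. y \<in> S \<Longrightarrow> f y = g y"
  shows "frechet_derivative f (at x) = frechet_derivative g (at x)"
proof -
  have "(f has_derivative f') (at x) \<longleftrightarrow> (g has_derivative f') (at x)" for f'
    using assms by (metis has_derivative_transform_within_open)
  then show ?thesis
    by (simp add: frechet_derivative_def)
qed

section \<open>Closure properties of smooth functions\<close>

lemma Ck_on_cong:
  assumes "open S" "\<And>x. x \<in> S \<Longrightarrow> f x = g x"
  shows "Ck_on k S f \<longleftrightarrow> Ck_on k S g"
  using assms(2)
proof (induction k arbitrary: f g)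
  case 0
  then show ?case
    by (simp cong: continuous_on_cong)
next
  case (Suc k)
  have "f differentiable_on S \<longleftrightarrow> g differentiable_on S"
    unfolding differentiable_on_def using Suc.prems
    by (metis (no_types, lifting) differentiable_transform_within zero_less_one)
  moreover have "Ck_on k S (\<lambda>x. frechet_derivative f (at x) v) \<longleftrightarrow>
      Ck_on k S (\<lambda>x. frechet_derivative g (at x) v)" for v
    using frechet_derivative_cong[OF assms(1) _ Suc.prems] by (intro Suc.IH) auto
  ultimately show ?case
    by simp
qed

lemma smooth_on_cong:
  "open S \<Longrightarrow> (\<And>x. x \<in> S \<Longrightarrow> f x = g x) \<Longrightarrow> smooth_on S f \<longleftrightarrow> smooth_on S g"
  unfolding smooth_on_def by (metis Ck_on_cong)

lemma Ck_on_mono: "Ck_on (Suc k) S f \<Longrightarrow> Ck_on k S f"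
proof (induction k arbitrary: f)
  case 0
  then show ?case
    by (simp add: differentiable_imp_continuous_on)
next
  case (Suc k)
  then show ?case
    by (metis Ck_on.simps(2))
qed

lemma smooth_on_differentiable_on: "smooth_on S f \<Longrightarrow> f differentiable_on S"
  unfolding smooth_on_def by (metis Ck_on.simps(2))

lemma smooth_on_continuous_on: "smooth_on S f \<Longrightarrow> continuous_on S f"
  by (simp add: smooth_on_differentiable_on differentiable_imp_continuous_on)

lemma smooth_on_has_derivative:
  "open S \<Longrightarrow> smooth_on S f \<Longrightarrow> x \<in> S \<Longrightarrow> (f has_derivative frechet_derivative f (at x)) (at x)"
  by (simp add: has_derivative_frechet_derivative smooth_on_differentiable_on)

lemma smooth_on_linear_derivative:
  assumes "open S" "smooth_on S f" "x \<in> S"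
  shows "linear (frechet_derivative f (at x))"
  using smooth_on_has_derivative[OF assms] by (rule has_derivative_linear)

lemma smooth_on_derivative: "smooth_on S f \<Longrightarrow> smooth_on S (\<lambda>x. frechet_derivative f (at x) v)"
  unfolding smooth_on_def by (metis Ck_on.simps(2))

lemma Ck_on_const: "Ck_on k S (\<lambda>x. c)"
  by (induction k arbitrary: c) (auto simp: frechet_derivative_const)

lemma smooth_on_const [intro, simp]: "smooth_on S (\<lambda>x. c)"
  by (simp add: smooth_on_def Ck_on_const)

lemma smooth_on_bounded_linear: "bounded_linear f \<Longrightarrow> smooth_on S f"
proof -
  assume f: "bounded_linear f"
  have "frechet_derivative f (at x) = f" for x
    using f by (intro frechet_derivative_eq bounded_linear_imp_has_derivative)
  with f have "Ck_on k S f" for k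
    by (cases k) (auto simp: Ck_on_const linear_continuous_on
        intro: bounded_linear_imp_differentiable_on)
  then show ?thesis
    by (simp add: smooth_on_def)
qed

lemma Ck_on_bounded_linear:
  assumes "open S" "bounded_linear L"
  shows "Ck_on k S f \<Longrightarrow> Ck_on k S (\<lambda>x. L (f x))"
proof (induction k arbitrary: f)
  case 0
  then show ?case
    using assms(2) by (simp add: bounded_linear.continuous_on)
next
  case (Suc k)
  then have "f differentiable_on S"
    by simp
  note d = has_derivative_frechet_derivative[OF assms(1) this]
  note d' = bounded_linear.has_derivative[OF assms(2) d]
  have "Ck_on k S (\<lambda>x. frechet_derivative (\<lambda>x. L (f x)) (at x) v)" for v
    using Suc by (subst Ck_on_cong[OF assms(1), where g = "\<lambda>x. L (frechet_derivative f (at x) v)"])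
      (simp_all add: frechet_derivative_eq[OF d'])
  moreover have "(\<lambda>x. L (f x)) differentiable_on S"
    using d' by (meson differentiable_def differentiable_on_def has_derivative_at_withinI)
  ultimately show ?case
    by simp
qed

lemma smooth_on_compose_bounded_linear:
  "open S \<Longrightarrow> bounded_linear L \<Longrightarrow> smooth_on S f \<Longrightarrow> smooth_on S (\<lambda>x. L (f x))"
  by (simp add: smooth_on_def Ck_on_bounded_linear)

lemma Ck_on_add:
  assumes "open S"
  shows "Ck_on k S f \<Longrightarrow> Ck_on k S g \<Longrightarrow> Ck_on k S (\<lambda>x. f x + g x)"
proof (induction k arbitrary: f g)
  case 0
  then show ?case
    by (simp add: continuous_on_add)
next
  case (Suc k)
  then have "f differentiable_on S" "g differentiable_on S"
    by simp_all
  note d = this[THEN has_derivative_frechet_derivative[OF assms(1)]]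
  note d' = has_derivative_add[OF d]
  have "Ck_on k S (\<lambda>x. frechet_derivative (\<lambda>x. f x + g x) (at x) v)" for v
    using Suc by (subst Ck_on_cong[OF assms(1),
        where g = "\<lambda>x. frechet_derivative f (at x) v + frechet_derivative g (at x) v"])
      (simp_all add: frechet_derivative_eq[OF d'])
  then show ?case
    using Suc.prems by simp
qed

lemma smooth_on_add:
  "open S \<Longrightarrow> smooth_on S f \<Longrightarrow> smooth_on S g \<Longrightarrow> smooth_on S (\<lambda>x. f x + g x)"
  by (simp add: smooth_on_def Ck_on_add)

lemma smooth_on_sum:
  "open S \<Longrightarrow> (\<And>i. i \<in> I \<Longrightarrow> smooth_on S (f i)) \<Longrightarrow> smooth_on S (\<lambda>x. \<Sum>i\<in>I. f i x)"
  by (induction I rule: infinite_finite_induct) (auto intro!: smooth_on_add)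

text \<open>Each summand of the product rule contains one undifferentiated factor.
  \<open>Ck_on_mono\<close> lowers that factor to order k, so that the induction hypothesis applies
  to both summands.\<close>

lemma Ck_on_bounded_bilinear:
  assumes "open S" "bounded_bilinear B"
  shows "Ck_on k S f \<Longrightarrow> Ck_on k S g \<Longrightarrow> Ck_on k S (\<lambda>x. B (f x) (g x))"
proof (induction k arbitrary: f g)
  case 0
  then show ?case
    using assms(2) by (simp add: bounded_bilinear.continuous_on)
next
  case (Suc k)
  then have "f differentiable_on S" "g differentiable_on S"
    by simp_all
  note d = this[THEN has_derivative_frechet_derivative[OF assms(1)]]
  note d' = bounded_bilinear.FDERIV[OF assms(2) d]
  note Suc.prems[THEN Ck_on_mono]
  then have "Ck_on k S (\<lambda>x. B (f x) (frechet_derivative g (at x) v) + B (frechet_derivative f (at x) v) (g x))" for v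
    using Suc.prems by (intro Ck_on_add assms Suc.IH) auto
  then have "Ck_on k S (\<lambda>x. frechet_derivative (\<lambda>x. B (f x) (g x)) (at x) v)" for v
    by (subst Ck_on_cong[OF assms(1),
        where g = "\<lambda>x. B (f x) (frechet_derivative g (at x) v) + B (frechet_derivative f (at x) v) (g x)"])
      (simp_all add: frechet_derivative_eq[OF d'])
  moreover have "(\<lambda>x. B (f x) (g x)) differentiable_on S"
    using d' by (meson differentiable_def differentiable_on_def has_derivative_at_withinI)
  ultimately show ?case
    by simp
qed

lemma smooth_on_bounded_bilinear:
  "open S \<Longrightarrow> bounded_bilinear B \<Longrightarrow> smooth_on S f \<Longrightarrow> smooth_on S g \<Longrightarrow>
    smooth_on S (\<lambda>x. B (f x) (g x))"
  by (simp add: smooth_on_def Ck_on_bounded_bilinear)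

lemma smooth_on_scaleR:
  "open S \<Longrightarrow> smooth_on S f \<Longrightarrow> smooth_on S g \<Longrightarrow> smooth_on S (\<lambda>x. f x *\<^sub>R g x)"
  by (rule smooth_on_bounded_bilinear[OF _ bounded_bilinear_scaleR])

lemma smooth_on_mult:
  fixes f g :: "_ \<Rightarrow> 'a::real_normed_algebra"
  shows "open S \<Longrightarrow> smooth_on S f \<Longrightarrow> smooth_on S g \<Longrightarrow> smooth_on S (\<lambda>x. f x * g x)"
  by (rule smooth_on_bounded_bilinear[OF _ bounded_bilinear_mult])

text \<open>The derivative of 1/f is a product of the derivative of f with two copies of 1/f, so
  order k of 1/f yields order k + 1.\<close>

lemma smooth_on_inverse:
  fixes f :: "'a::euclidean_space \<Rightarrow> real"
  assumes "open S" "smooth_on S f" "\<And>x. x \<in> S \<Longrightarrow> f x \<noteq> 0"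
  shows "smooth_on S (\<lambda>x. inverse (f x))"
proof -
  have "Ck_on k S (\<lambda>x. inverse (f x))" for k
  proof (induction k)
    case 0
    show ?case
      using assms by (simp add: smooth_on_continuous_on continuous_on_inverse)
  next
    case (Suc k)
    note d = Deriv.has_derivative_inverse[OF assms(3) smooth_on_has_derivative[OF assms(1,2)]]
    have "Ck_on k S (\<lambda>x. - 1 * (inverse (f x) * frechet_derivative f (at x) v * inverse (f x)))" for v
      using smooth_on_derivative[OF assms(2), of v] Suc
      by (intro Ck_on_bounded_bilinear[OF assms(1) bounded_bilinear_mult] Ck_on_const)
        (auto simp: smooth_on_def)
    then have "Ck_on k S (\<lambda>x. frechet_derivative (\<lambda>x. inverse (f x)) (at x) v)" for v
      by (subst Ck_on_cong[OF assms(1),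
        where g = "\<lambda>x. - 1 * (inverse (f x) * frechet_derivative f (at x) v * inverse (f x))"])
      (simp_all add: frechet_derivative_eq[OF d])
    moreover have "(\<lambda>x. inverse (f x)) differentiable_on S"
      using d by (meson differentiable_def differentiable_on_def has_derivative_at_withinI)
    ultimately show ?case
      by simp
  qed
  then show ?thesis
    by (simp add: smooth_on_def)
qed

text \<open>The inner maps of interest are left translations, which are linear in the matrix. The
  direction \<open>L v\<close> then does not move with the point, and the induction closes on
  derivatives of f in fixed directions.\<close>

lemma Ck_on_compose_linear:
  assumes "open S" "open T" "bounded_linear L" "\<And>x. x \<in> S \<Longrightarrow> L x \<in> T"
  shows "Ck_on k T f \<Longrightarrow> Ck_on k S (\<lambda>x. f (L x))"
proof (induction k arbitrary: f)
  case 0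
  moreover have "continuous_on S L"
    using assms(3) by (simp add: linear_continuous_on)
  ultimately show ?case
    using assms(4) by (auto intro: continuous_on_compose2)
next
  case (Suc k)
  have d: "((\<lambda>x. f (L x)) has_derivative (\<lambda>v. frechet_derivative f (at (L x)) (L v))) (at x)"
    if "x \<in> S" for x
    using that Suc.prems
    by (intro has_derivative_compose[OF bounded_linear_imp_has_derivative[OF assms(3)]]
        has_derivative_frechet_derivative[OF assms(2) _ assms(4)]) auto
  have "Ck_on k S (\<lambda>x. frechet_derivative (\<lambda>x. f (L x)) (at x) v)" for v
    using Suc.prems Suc.IH[of "\<lambda>x. frechet_derivative f (at x) (L v)"]
    by (subst Ck_on_cong[OF assms(1),
        where g = "\<lambda>x. frechet_derivative f (at (L x)) (L v)"])
      (simp_all add: frechet_derivative_eq[OF d])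
  moreover have "(\<lambda>x. f (L x)) differentiable_on S"
    using d by (meson differentiable_def differentiable_on_def has_derivative_at_withinI)
  ultimately show ?case
    by simp
qed

lemma smooth_on_compose_linear:
  "open S \<Longrightarrow> open T \<Longrightarrow> bounded_linear L \<Longrightarrow> (\<And>x. x \<in> S \<Longrightarrow> L x \<in> T) \<Longrightarrow> smooth_on T f \<Longrightarrow>
    smooth_on S (\<lambda>x. f (L x))"
  unfolding smooth_on_def by (metis Ck_on_compose_linear)

lemma frechet_derivative_compose_linear:
  assumes "open T" "smooth_on T f" "bounded_linear L" "L x \<in> T"
  shows "frechet_derivative (\<lambda>x. f (L x)) (at x) v = frechet_derivative f (at (L x)) (L v)"
proof -
  have "((\<lambda>x. f (L x)) has_derivative (\<lambda>v. frechet_derivative f (at (L x)) (L v))) (at x)"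
    by (rule has_derivative_compose[OF bounded_linear_imp_has_derivative[OF assms(3)]
          smooth_on_has_derivative[OF assms(1,2,4)]])
  then show ?thesis
    by (simp add: frechet_derivative_eq)
qed

section \<open>Derivatives along a vector field\<close>

lemma linear_eq_sum_Basis:
  fixes f :: "'a::euclidean_space \<Rightarrow> 'b::real_vector"
  assumes "linear f"
  shows "f v = (\<Sum>b\<in>Basis. (v \<bullet> b) *\<^sub>R f b)"
  using assms by (metis (no_types, lifting) euclidean_representation linear_scale linear_sum sum.cong)

lemma derivative_along_eq_sum:
  assumes "open S" "smooth_on S f" "x \<in> S"
  shows "frechet_derivative f (at x) v =
    (\<Sum>b\<in>Basis. (v \<bullet> b) *\<^sub>R frechet_derivative f (at x) b)"
  using smooth_on_linear_derivative[OF assms] by (rule linear_eq_sum_Basis)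

text \<open>\<open>Ck_on\<close> speaks of fixed directions only; expanding the moving direction in
  the basis separates it from the derivative.\<close>

lemma smooth_on_derivative_along:
  assumes "open S" "smooth_on S f" "smooth_on S V"
  shows "smooth_on S (\<lambda>x. frechet_derivative f (at x) (V x))"
proof -
  have "smooth_on S (\<lambda>x. \<Sum>b\<in>Basis. (V x \<bullet> b) *\<^sub>R frechet_derivative f (at x) b)"
    using assms by (intro smooth_on_sum smooth_on_scaleR smooth_on_derivative
        smooth_on_compose_bounded_linear[OF _ bounded_linear_inner_left])
  then show ?thesis
    using smooth_on_cong[OF assms(1) derivative_along_eq_sum[OF assms(1,2)]] by simp
qed

lemma frechet_derivative_derivative_along:
  assumes "open S" "smooth_on S f" "smooth_on S V" "x \<in> S"
  shows "frechet_derivative (\<lambda>y. frechet_derivative f (at y) (V y)) (at x) u =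
    frechet_derivative (\<lambda>y. frechet_derivative f (at y) (V x)) (at x) u
    + frechet_derivative f (at x) (frechet_derivative V (at x) u)"
proof -
  let ?D = "\<lambda>b. frechet_derivative (\<lambda>y. frechet_derivative f (at y) b) (at x)"
  have dD: "((\<lambda>y. frechet_derivative f (at y) b) has_derivative ?D b) (at x)" for b
    using assms by (intro smooth_on_has_derivative smooth_on_derivative)
  have dV: "((\<lambda>y. V y \<bullet> b) has_derivative (\<lambda>u. frechet_derivative V (at x) u \<bullet> b)) (at x)" for b
    using assms by (intro has_derivative_inner_left smooth_on_has_derivative)
  have "frechet_derivative (\<lambda>y. frechet_derivative f (at y) (V y)) (at x) =
      frechet_derivative (\<lambda>y. \<Sum>b\<in>Basis. (V y \<bullet> b) *\<^sub>R frechet_derivative f (at y) b) (at x)"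
    by (rule frechet_derivative_cong[OF assms(1,4) derivative_along_eq_sum[OF assms(1,2)]])
  also have "\<dots> = (\<lambda>u. \<Sum>b\<in>Basis. (V x \<bullet> b) *\<^sub>R ?D b u
      + (frechet_derivative V (at x) u \<bullet> b) *\<^sub>R frechet_derivative f (at x) b)"
    by (intro frechet_derivative_eq has_derivative_sum has_derivative_scaleR dV dD)
  finally have 1: "frechet_derivative (\<lambda>y. frechet_derivative f (at y) (V y)) (at x) u =
      (\<Sum>b\<in>Basis. (V x \<bullet> b) *\<^sub>R ?D b u)
      + frechet_derivative f (at x) (frechet_derivative V (at x) u)"
    by (simp only: sum.distrib
        derivative_along_eq_sum[OF assms(1,2,4), of "frechet_derivative V (at x) u"])
  have "?D (V x) =
      frechet_derivative (\<lambda>y. \<Sum>b\<in>Basis. (V x \<bullet> b) *\<^sub>R frechet_derivative f (at y) b) (at x)"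
    by (rule frechet_derivative_cong[OF assms(1,4) derivative_along_eq_sum[OF assms(1,2)]])
  also have "\<dots> = (\<lambda>u. \<Sum>b\<in>Basis. (V x \<bullet> b) *\<^sub>R ?D b u)"
    by (intro frechet_derivative_eq has_derivative_sum has_derivative_scaleR_right dD)
  finally show ?thesis
    using 1 by simp
qed

section \<open>Symmetry of second derivatives\<close>

lemma second_difference_mean_value:
  fixes f :: "'a::euclidean_space \<Rightarrow> real"
  assumes "open S" "smooth_on S f" "0 < r"
    and in_S: "\<And>s t. 0 \<le> s \<Longrightarrow> s \<le> r \<Longrightarrow> 0 \<le> t \<Longrightarrow> t \<le> r \<Longrightarrow> x + s *\<^sub>R u + t *\<^sub>R v \<in> S"
  obtains s t where "0 < s" "s < r" "0 < t" "t < r"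
    "f (x + r *\<^sub>R u + r *\<^sub>R v) - f (x + r *\<^sub>R u) - f (x + r *\<^sub>R v) + f x =
      r * r * frechet_derivative (\<lambda>y. frechet_derivative f (at y) u) (at (x + s *\<^sub>R u + t *\<^sub>R v)) v"
proof -
  let ?p = "\<lambda>s t. x + s *\<^sub>R u + t *\<^sub>R v"
  have d: "((\<lambda>s. g (?p s t)) has_real_derivative frechet_derivative g (at (?p s t)) u) (at s)"
    "((\<lambda>t. g (?p s t)) has_real_derivative frechet_derivative g (at (?p s t)) v) (at t)"
    if "smooth_on S g" "0 \<le> s" "s \<le> r" "0 \<le> t" "t \<le> r" for g :: "'a \<Rightarrow> real" and s t
  proof -
    have g: "(g has_derivative frechet_derivative g (at (?p s t))) (at (?p s t))"
      using smooth_on_has_derivative[OF assms(1) that(1) in_S[OF that(2-)]] .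
    have lin: "linear (frechet_derivative g (at (?p s t)))"
      using g by (rule has_derivative_linear)
    have "((\<lambda>s. ?p s t) has_derivative (\<lambda>h. h *\<^sub>R u)) (at s)"
      "((\<lambda>t. ?p s t) has_derivative (\<lambda>h. h *\<^sub>R v)) (at t)"
      by (auto intro!: derivative_eq_intros)
    from this[THEN has_derivative_compose, OF g]
    show "((\<lambda>s. g (?p s t)) has_real_derivative frechet_derivative g (at (?p s t)) u) (at s)"
      "((\<lambda>t. g (?p s t)) has_real_derivative frechet_derivative g (at (?p s t)) v) (at t)"
      by (simp_all add: has_field_derivative_def linear_scale[OF lin] mult_commute_abs)
  qed
  \<comment> \<open>Mean value theorem in s for the difference of f between the edges t = r and t =
    0 of the parallelogram.\<close>
  obtain s where s: "0 < s" "s < r" "(f (?p r r) - f (?p r 0)) - (f (?p 0 r) - f (?p 0 0)) =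
      (r - 0) * (frechet_derivative f (at (?p s r)) u - frechet_derivative f (at (?p s 0)) u)"
    by (atomize_elim, rule MVT2[OF \<open>0 < r\<close> DERIV_diff[OF d(1)[OF assms(2)] d(1)[OF assms(2)]]])
      (use \<open>0 < r\<close> in auto)
  obtain t where t: "0 < t" "t < r"
    "frechet_derivative f (at (?p s r)) u - frechet_derivative f (at (?p s 0)) u =
      (r - 0) * frechet_derivative (\<lambda>y. frechet_derivative f (at y) u) (at (?p s t)) v"
    by (atomize_elim, rule MVT2[OF \<open>0 < r\<close> d(2)[OF smooth_on_derivative[OF assms(2)]]])
      (use s in auto)
  show ?thesis
    using s t by (intro that[of s t]) (simp_all add: algebra_simps)
qed

text \<open>Both mixed derivatives are limits of the same second difference quotient.\<close>

lemma second_derivative_symmetric: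
  fixes f :: "'a::euclidean_space \<Rightarrow> real"
  assumes "open S" "smooth_on S f" "x \<in> S"
  shows "frechet_derivative (\<lambda>y. frechet_derivative f (at y) u) (at x) v =
    frechet_derivative (\<lambda>y. frechet_derivative f (at y) v) (at x) u" (is "?F u v x = ?F v u x")
proof (rule ccontr)
  assume "?F u v x \<noteq> ?F v u x"
  define e where "e = \<bar>?F u v x - ?F v u x\<bar> / 2"
  have e: "0 < e"
    using \<open>?F u v x \<noteq> ?F v u x\<close> by (simp add: e_def)
  have near: "\<exists>d>0. \<forall>y. dist y x < d \<longrightarrow> y \<in> S \<and> \<bar>?F u v y - ?F u v x\<bar> < e" for u v
  proof -
    have "isCont (?F u v) x"
      using smooth_on_continuous_on[OF smooth_on_derivative[OF smooth_on_derivative[OF assms(2)]]]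
        assms(1,3) continuous_on_eq_continuous_at by blast
    then obtain d1 where d1: "0 < d1" "\<And>y. dist y x < d1 \<Longrightarrow> \<bar>?F u v y - ?F u v x\<bar> < e"
      using e unfolding continuous_at_eps_delta dist_real_def by blast
    obtain d2 where "0 < d2" "\<And>y. dist y x < d2 \<Longrightarrow> y \<in> S"
      using assms(1,3) unfolding open_dist by blast
    with d1 show ?thesis
      by (intro exI[of _ "min d1 d2"]) auto
  qed
  obtain d where d: "0 < d" "\<And>y. dist y x < d \<Longrightarrow> y \<in> S"
    "\<And>y. dist y x < d \<Longrightarrow> \<bar>?F u v y - ?F u v x\<bar> < e"
    "\<And>y. dist y x < d \<Longrightarrow> \<bar>?F v u y - ?F v u x\<bar> < e"
  proof -
    obtain d1 d2 where "0 < d1" "\<forall>y. dist y x < d1 \<longrightarrow> y \<in> S \<and> \<bar>?F u v y - ?F u v x\<bar> < e"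
      "0 < d2" "\<forall>y. dist y x < d2 \<longrightarrow> y \<in> S \<and> \<bar>?F v u y - ?F v u x\<bar> < e"
      using near[of u v] near[of v u] by blast
    then show ?thesis
      by (intro that[of "min d1 d2"]) auto
  qed
  \<comment> \<open>This side length keeps the whole parallelogram within distance d of x; the
    summand 1 covers the case u = v = 0.\<close>
  define r where "r = d / (1 + norm u + norm v)"
  have pos: "0 < 1 + norm u + norm v"
    by (simp add: add_pos_nonneg)
  then have r: "0 < r"
    using d(1) by (simp add: r_def)
  have close: "dist (x + s *\<^sub>R u + t *\<^sub>R v) x < d"
    if "0 \<le> s" "s \<le> r" "0 \<le> t" "t \<le> r" for s t
  proof -
    have "norm (s *\<^sub>R u + t *\<^sub>R v) \<le> s * norm u + t * norm v"
      using that norm_triangle_ineq[of "s *\<^sub>R u" "t *\<^sub>R v"] by simp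
    also have "\<dots> \<le> r * norm u + r * norm v"
      using that by (intro add_mono mult_right_mono) auto
    also have "\<dots> < r * (1 + norm u + norm v)"
      using r by (simp add: algebra_simps)
    also have "\<dots> = d"
      using pos by (simp add: r_def)
    finally show ?thesis
      by (simp add: dist_norm add.assoc)
  qed
  obtain s t where st: "0 < s" "s < r" "0 < t" "t < r"
    "f (x + r *\<^sub>R u + r *\<^sub>R v) - f (x + r *\<^sub>R u) - f (x + r *\<^sub>R v) + f x =
      r * r * ?F u v (x + s *\<^sub>R u + t *\<^sub>R v)"
    using second_difference_mean_value[OF assms(1,2) r d(2)[OF close]] by blast
  have in_S: "x + s *\<^sub>R v + t *\<^sub>R u \<in> S" if "0 \<le> s" "s \<le> r" "0 \<le> t" "t \<le> r" for s t
    using d(2)[OF close, of t s] that by (simp add: ac_simps)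
  obtain s' t' where st': "0 < s'" "s' < r" "0 < t'" "t' < r"
    "f (x + r *\<^sub>R v + r *\<^sub>R u) - f (x + r *\<^sub>R v) - f (x + r *\<^sub>R u) + f x =
      r * r * ?F v u (x + s' *\<^sub>R v + t' *\<^sub>R u)"
    using second_difference_mean_value[OF assms(1,2) r in_S] by blast
  \<comment> \<open>The second difference is unchanged when u and v are exchanged, so the two mean
    value expressions coincide.\<close>
  have "x + r *\<^sub>R v + r *\<^sub>R u = x + r *\<^sub>R u + r *\<^sub>R v" "x + s' *\<^sub>R v + t' *\<^sub>R u = x + t' *\<^sub>R u + s' *\<^sub>R v"
    by (simp_all add: ac_simps)
  note swap = this
  have "r * r * ?F u v (x + s *\<^sub>R u + t *\<^sub>R v) = r * r * ?F v u (x + t' *\<^sub>R u + s' *\<^sub>R v)"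
    unfolding st(5)[symmetric] st'(5)[unfolded swap, symmetric] by simp
  then have "?F u v (x + s *\<^sub>R u + t *\<^sub>R v) = ?F v u (x + t' *\<^sub>R u + s' *\<^sub>R v)"
    using r by simp
  moreover have "\<bar>?F u v (x + s *\<^sub>R u + t *\<^sub>R v) - ?F u v x\<bar> < e"
    "\<bar>?F v u (x + t' *\<^sub>R u + s' *\<^sub>R v) - ?F v u x\<bar> < e"
    using st st' by (auto intro!: d(3,4) close)
  moreover have "\<bar>?F u v x - ?F v u x\<bar> = 2 * e"
    by (simp add: e_def)
  ultimately show False
    by linarith
qed

section \<open>The group Gl(2,R)\<close>

lemma bounded_bilinear_matrix_mult:
  "bounded_bilinear ((**) :: real^'n^'m \<Rightarrow> real^'p^'n \<Rightarrow> real^'p^'m)"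
  unfolding bilinear_conv_bounded_bilinear[symmetric]
  by (auto simp: bilinear_def vec_eq_iff matrix_matrix_mult_def sum.distrib sum_distrib_left algebra_simps
      intro!: linearI)

lemmas matrix_mult_linear_simps =
  bounded_bilinear.add_left[OF bounded_bilinear_matrix_mult]
  bounded_bilinear.add_right[OF bounded_bilinear_matrix_mult]
  bounded_bilinear.diff_left[OF bounded_bilinear_matrix_mult]
  bounded_bilinear.diff_right[OF bounded_bilinear_matrix_mult]
  bounded_bilinear.minus_left[OF bounded_bilinear_matrix_mult]
  bounded_bilinear.minus_right[OF bounded_bilinear_matrix_mult]
  bounded_bilinear.scaleR_left[OF bounded_bilinear_matrix_mult]
  bounded_bilinear.scaleR_right[OF bounded_bilinear_matrix_mult]

lemmas bounded_linear_matrix_mult_left = bounded_bilinear.bounded_linear_left[OF bounded_bilinear_matrix_mult]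
lemmas bounded_linear_matrix_mult_right = bounded_bilinear.bounded_linear_right[OF bounded_bilinear_matrix_mult]

lemma matrix_eq_2: "A = B \<longleftrightarrow> A$1$1 = B$1$1 \<and> A$1$2 = B$1$2 \<and> A$2$1 = B$2$1 \<and> A$2$2 = B$2$2"
  for A B :: "'a^2^2"
  by (auto simp: vec_eq_iff forall_2)

lemma bounded_linear_entry: "bounded_linear (\<lambda>A::real^'n^'m. A$i$j)"
  by (intro bounded_linear_compose[OF bounded_linear_vec_nth] bounded_linear_vec_nth)

lemma smooth_on_entry: "open S \<Longrightarrow> smooth_on S f \<Longrightarrow> smooth_on S (\<lambda>x. (f x :: real^'n^'m)$i$j)"
  by (rule smooth_on_compose_bounded_linear[OF _ bounded_linear_entry])

lemma GL2_iff_det: "A \<in> GL2 \<longleftrightarrow> det A \<noteq> 0"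
  by (simp add: GL2_def invertible_det_nz)

lemma open_GL2: "open GL2"
proof -
  have "GL2 = {A. det A \<noteq> 0}"
    by (auto simp: GL2_iff_det)
  also have "open \<dots>"
    unfolding det_2 by (intro open_Collect_neq continuous_intros)
  finally show ?thesis .
qed

lemma matrix_inv_left: "A \<in> GL2 \<Longrightarrow> matrix_inv A ** A = mat 1"
  and matrix_inv_right: "A \<in> GL2 \<Longrightarrow> A ** matrix_inv A = mat 1"
  unfolding GL2_def invertible_def matrix_inv_def
  by (metis (mono_tags, lifting) mem_Collect_eq someI_ex)+

lemma matrix_inv_eqI: "A \<in> GL2 \<Longrightarrow> B ** A = mat 1 \<Longrightarrow> matrix_inv A = B"
  by (metis matrix_inv_right matrix_mul_assoc matrix_mul_lid matrix_mul_rid)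

lemma matrix_inv_2:
  assumes "A \<in> GL2"
  shows "matrix_inv A = inverse (det A) *\<^sub>R vector [vector [A$2$2, - A$1$2], vector [- A$2$1, A$1$1]]"
proof (rule matrix_inv_eqI[OF assms])
  have "vector [vector [A$2$2, - A$1$2], vector [- A$2$1, A$1$1]] ** A = det A *\<^sub>R mat 1"
    by (simp add: matrix_eq_2 matrix_matrix_mult_def sum_2 mat_def det_2)
  then show "inverse (det A) *\<^sub>R vector [vector [A$2$2, - A$1$2], vector [- A$2$1, A$1$1]] ** A = mat 1"
    using assms by (simp add: matrix_mult_linear_simps GL2_iff_det)
qed

lemma matrix_mult_GL2: "A \<in> GL2 \<Longrightarrow> B \<in> GL2 \<Longrightarrow> A ** B \<in> GL2"
  by (simp add: GL2_iff_det det_mul)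

lemma scaleR_GL2: "A \<in> GL2 \<Longrightarrow> c \<noteq> 0 \<Longrightarrow> c *\<^sub>R A \<in> GL2"
proof -
  have "det (c *\<^sub>R A) = c * c * det A"
    by (simp add: det_2 algebra_simps)
  then show "A \<in> GL2 \<Longrightarrow> c \<noteq> 0 \<Longrightarrow> c *\<^sub>R A \<in> GL2"
    by (simp add: GL2_iff_det)
qed

lemma matrix_inv_GL2: "A \<in> GL2 \<Longrightarrow> matrix_inv A \<in> GL2"
  using matrix_inv_left matrix_inv_right by (auto simp: GL2_def invertible_def)

lemma matrix_inv_scaleR: "A \<in> GL2 \<Longrightarrow> c \<noteq> 0 \<Longrightarrow> matrix_inv (c *\<^sub>R A) = inverse c *\<^sub>R matrix_inv A"
  by (intro matrix_inv_eqI) (simp_all add: scaleR_GL2 matrix_mult_linear_simps matrix_inv_left)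

lemma smooth_on_matrix_inv: "smooth_on GL2 matrix_inv"
proof -
  let ?adj = "\<lambda>A::gl2. vector [vector [A$2$2, - A$1$2], vector [- A$2$1, A$1$1]] :: gl2"
  have "bounded_linear ?adj"
    by (auto simp: linear_conv_bounded_linear[symmetric] matrix_eq_2 intro!: linearI)
  moreover have "smooth_on GL2 (\<lambda>A. det A)"
  proof -
    have "smooth_on GL2 (\<lambda>A. A$1$1 * A$2$2 + (- 1) * (A$1$2 * A$2$1))"
      by (intro smooth_on_add smooth_on_mult open_GL2 smooth_on_bounded_linear bounded_linear_entry
          smooth_on_const)
    then show ?thesis
      by (simp add: det_2)
  qed
  ultimately have "smooth_on GL2 (\<lambda>A. inverse (det A) *\<^sub>R ?adj A)"
    using open_GL2 by (intro smooth_on_scaleR smooth_on_inverse)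
      (auto simp: GL2_iff_det intro: smooth_on_bounded_linear)
  then show ?thesis
    using smooth_on_cong[OF open_GL2 matrix_inv_2] by simp
qed

text \<open>Smoothness provides some derivative; differentiating
  \<open>matrix_inv B ** B = mat 1\<close> determines it.\<close>

lemma matrix_inv_has_derivative:
  assumes "A \<in> GL2"
  shows "(matrix_inv has_derivative (\<lambda>V. - (matrix_inv A ** V ** matrix_inv A))) (at A)"
proof -
  let ?D = "frechet_derivative matrix_inv (at A)"
  have D: "(matrix_inv has_derivative ?D) (at A)"
    by (rule smooth_on_has_derivative[OF open_GL2 smooth_on_matrix_inv assms])
  then have "((\<lambda>B. matrix_inv B ** B) has_derivative (\<lambda>V. matrix_inv A ** V + ?D V ** A)) (at A)"
    by (rule bounded_bilinear.FDERIV[OF bounded_bilinear_matrix_mult _ has_derivative_ident])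
  then have "((\<lambda>B. mat 1 :: gl2) has_derivative (\<lambda>V. matrix_inv A ** V + ?D V ** A)) (at A)"
    by (rule has_derivative_transform_within_open[OF _ open_GL2 assms]) (simp add: matrix_inv_left)
  then have "(\<lambda>V. matrix_inv A ** V + ?D V ** A) = (\<lambda>V. 0)"
    using has_derivative_unique has_derivative_const by blast
  from fun_cong[OF this] have "?D V ** A = - (matrix_inv A ** V)" for V
    by (simp add: add_eq_0_iff)
  then have "?D V ** A ** matrix_inv A = - (matrix_inv A ** V ** matrix_inv A)" for V
    by (simp add: matrix_mult_linear_simps)
  then have "?D = (\<lambda>V. - (matrix_inv A ** V ** matrix_inv A))"
    by (simp add: matrix_mul_assoc[symmetric] matrix_inv_right assms fun_eq_iff)
  with D show ?thesis
    by simp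
qed

section \<open>Scalars, the center and its cosets\<close>

lemma mexp_scalar: "mexp (c *\<^sub>R mat 1) = exp c *\<^sub>R mat 1"
proof -
  have pow: "(((**) (c *\<^sub>R mat 1)) ^^ k) (mat 1) = c ^ k *\<^sub>R (mat 1 :: gl2)" for k
    by (induction k) (simp_all add: matrix_mult_linear_simps)
  have "(\<lambda>k. (1 / fact k) *\<^sub>R (((**) (c *\<^sub>R mat 1)) ^^ k) (mat 1)) =
      (\<lambda>k. (c ^ k /\<^sub>R fact k) *\<^sub>R (mat 1 :: gl2))"
    by (simp add: pow divide_inverse_commute)
  moreover have "(\<lambda>k. (c ^ k /\<^sub>R fact k) *\<^sub>R (mat 1 :: gl2)) sums (exp c *\<^sub>R mat 1)"
    by (intro sums_scaleR_left exp_converges)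
  ultimately show ?thesis
    unfolding mexp_def by (simp add: sums_iff)
qed

lemma gl2_center_eq: "gl2_center = span {mat 1}"
proof
  show "gl2_center \<subseteq> span {mat 1}"
  proof
    fix Z :: gl2
    assume "Z \<in> gl2_center"
    then have comm: "Z ** Y = Y ** Z" for Y
      by (simp add: gl2_center_def mat_bracket_def)
    \<comment> \<open>Commuting with the two off-diagonal matrix units already kills the
      off-diagonal entries and equates the diagonal ones.\<close>
    have "Z = Z$1$1 *\<^sub>R mat 1"
      using comm[of "vector [vector [0, 1], vector [0, 0]]"] comm[of "vector [vector [0, 0], vector [1, 0]]"]
      by (simp add: matrix_eq_2 matrix_matrix_mult_def sum_2 mat_def)
    then show "Z \<in> span {mat 1}"
      by (metis span_base span_scale singletonI)
  qed
  show "span {mat 1} \<subseteq> gl2_center"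
    by (auto simp: span_singleton gl2_center_def mat_bracket_def matrix_mult_linear_simps)
qed

lemma central_R_eq: "central_R = {c *\<^sub>R mat 1 | c. 0 < c}"
proof -
  have "central_R = range (\<lambda>c. exp c *\<^sub>R mat 1)"
    by (simp add: central_R_def gl2_center_eq span_singleton image_image mexp_scalar)
  also have "\<dots> = (\<lambda>c. c *\<^sub>R mat 1) ` range exp"
    by blast
  also have "range exp = {0::real<..}"
    by (metis exp_gt_zero exp_ln greaterThan_iff image_subsetI range_eqI subsetI subset_antisym)
  finally show ?thesis
    by auto
qed

text \<open>Exponentials of real scalars are positive, so the cosets are open rays rather than
  punctured lines. Functions on the quotient are thus the functions on \<open>GL2\<close> invariant
  under positive scaling.\<close>

lemma coset_proj_eq: "coset_proj A = {c *\<^sub>R A | c. 0 < c}"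
  by (auto simp: coset_proj_def central_R_eq matrix_mult_linear_simps intro!: image_eqI)

lemma coset_proj_eq_iff: "coset_proj A = coset_proj B \<longleftrightarrow> (\<exists>c>0. B = c *\<^sub>R A)"
proof
  assume "coset_proj A = coset_proj B"
  moreover have "B \<in> coset_proj B"
    by (auto simp: coset_proj_eq intro: exI[of _ 1])
  ultimately show "\<exists>c>0. B = c *\<^sub>R A"
    by (auto simp: coset_proj_eq)
next
  assume "\<exists>c>0. B = c *\<^sub>R A"
  then obtain c where c: "0 < c" "B = c *\<^sub>R A"
    by blast
  then have "r *\<^sub>R A = (r / c) *\<^sub>R B" "r *\<^sub>R B = (r * c) *\<^sub>R A" for r
    by simp_all
  with c(1) show "coset_proj A = coset_proj B"
    unfolding coset_proj_eq using divide_pos_pos[of _ c] mult_pos_pos[of _ c]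
    by (intro set_eqI iffI CollectI) blast+
qed

text \<open>The flow is multiplication by exp t, so the central field is the Euler field.\<close>

lemma left_translation_field_mat_1: "left_translation_field (mat 1) = (\<lambda>A. A)"
proof
  fix A :: gl2
  have "((\<lambda>t. exp t *\<^sub>R A) has_vector_derivative exp 0 *\<^sub>R A) (at 0)"
    by (auto intro!: derivative_eq_intros simp: has_vector_derivative_def)
  then show "left_translation_field (mat 1) A = A"
    by (simp add: left_translation_field_def mexp_scalar matrix_mult_linear_simps vector_derivative_at)
qed

section \<open>The left-invariant Cartan connection\<close>

lemma vector_4 [simp]:
  "(vector [a, b, c, d] :: 'a::zero^4)$1 = a"
  "(vector [a, b, c, d] :: 'a::zero^4)$2 = b"
  "(vector [a, b, c, d] :: 'a::zero^4)$3 = c"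
  "(vector [a, b, c, d] :: 'a::zero^4)$4 = d"
  unfolding vector_def by simp_all

lemma vector_6 [simp]:
  "(vector [a, b, c, d, e, f] :: 'a::zero^6)$1 = a"
  "(vector [a, b, c, d, e, f] :: 'a::zero^6)$2 = b"
  "(vector [a, b, c, d, e, f] :: 'a::zero^6)$3 = c"
  "(vector [a, b, c, d, e, f] :: 'a::zero^6)$4 = d"
  "(vector [a, b, c, d, e, f] :: 'a::zero^6)$5 = e"
  "(vector [a, b, c, d, e, f] :: 'a::zero^6)$6 = f"
  unfolding vector_def by simp_all

lemma exhaust_6:
  fixes x :: 6
  shows "x = 1 \<or> x = 2 \<or> x = 3 \<or> x = 4 \<or> x = 5 \<or> x = 6"
proof (induct x)
  case (of_int z)
  then have "z = 0 \<or> z = 1 \<or> z = 2 \<or> z = 3 \<or> z = 4 \<or> z = 5" by simp arith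
  then show ?case by auto
qed

lemma forall_6: "(\<forall>i::6. P i) \<longleftrightarrow> P 1 \<and> P 2 \<and> P 3 \<and> P 4 \<and> P 5 \<and> P 6"
  by (metis exhaust_6)

lemma UNIV_6: "(UNIV :: 6 set) = {1, 2, 3, 4, 5, 6}"
  using exhaust_6 by auto

lemma sum_6: "sum f (UNIV :: 6 set) = f 1 + f 2 + f 3 + f 4 + f 5 + f 6"
  unfolding UNIV_6 by (simp add: ac_simps)

lemma sqrt_3_mult: "sqrt 3 * (sqrt 3 * a) = 3 * a"
  by (simp flip: mult.assoc)

section \<open>Coordinates and structure constants of gl(2,R)\<close>

definition gl2_coords :: "gl2 \<Rightarrow> real^4" where
  "gl2_coords X = vector [(7 * X$1$1 - X$2$2) / 12, (X$1$2 + X$2$1) / sqrt 3,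
     sqrt 3 * (X$2$1 - X$1$2), 2 * (X$2$2 - X$1$1)]"

lemma gl2_coords_gl2_of: "gl2_coords (gl2_of x) = x"
  by (simp add: gl2_coords_def gl2_of_def vec_eq_iff forall_4 field_simps)

lemma gl2_of_gl2_coords: "gl2_of (gl2_coords X) = X"
  by (simp add: gl2_coords_def gl2_of_def matrix_eq_2 field_simps sqrt_3_mult)

lemma \<alpha>_minus1_eq: "\<alpha>_minus1 = gl2_coords"
  unfolding \<alpha>_minus1_def by (rule inv_unique_comp) (auto simp: gl2_coords_gl2_of gl2_of_gl2_coords)

lemma bounded_linear_gl2_coords: "bounded_linear gl2_coords"
  unfolding linear_conv_bounded_linear[symmetric]
  by (auto simp: gl2_coords_def vec_eq_iff forall_4 algebra_simps add_divide_distrib diff_divide_distrib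
      intro!: linearI)

text \<open>The Lie bracket in the x-coordinates. The entries \<open>x$1\<close> and
  \<open>y$1\<close> are absent because the x1-direction is central; the last component is -2 times
  the area form of the x2,x3-plane, which is what makes the distribution contact.\<close>

definition coord_bracket :: "real^4 \<Rightarrow> real^4 \<Rightarrow> real^4" where
  "coord_bracket x y = vector
     [(x$2 * y$3 - x$3 * y$2) / 3, (x$4 * y$3 - x$3 * y$4) / 6,
      3 / 2 * (x$4 * y$2 - x$2 * y$4), - 2 * (x$2 * y$3 - x$3 * y$2)]"

lemma mat_bracket_gl2_of: "mat_bracket (gl2_of x) (gl2_of y) = gl2_of (coord_bracket x y)"
  by (simp add: mat_bracket_def matrix_eq_2 gl2_of_def coord_bracket_def matrix_matrix_mult_def sum_2
      field_simps sqrt_3_mult)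

lemma gl2_coords_mat_bracket:
  "gl2_coords (mat_bracket X Y) = coord_bracket (gl2_coords X) (gl2_coords Y)"
  by (metis mat_bracket_gl2_of gl2_coords_gl2_of gl2_of_gl2_coords)

section \<open>The linear map into so(2,4) and its curvature\<close>

text \<open>The central \<open>4 \<times> 4\<close> block is the Levi-Civita connection of the left-invariant metric; the first
  row is then the unique solution of the normality equations.\<close>

definition tractor_of :: "real^4 \<Rightarrow> real^6^6" where
  "tractor_of x = vector
    [vector [0, - x$1, x$2, - 2/3 * x$3, 2/3 * x$4, 0],
     vector [x$1, 0, 2/3 * x$3, x$2, 0, - 2/3 * x$4],
     vector [x$2, - x$3, 0, - x$1 - x$4 / 2, - 2/3 * x$3, - x$2],
     vector [x$3, x$2, x$1 + x$4 / 2, 0, - x$2, 2/3 * x$3],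
     vector [x$4, 0, x$3, - x$2, 0, x$1],
     vector [0, - x$4, - x$2, - x$3, - x$1, 0]]"

text \<open>The failure of \<open>tractor_of\<close> to respect brackets. The zero first column is
  vanishing torsion, the first row (mirrored in the last column) is the Cotton part, the remaining
  entries are the Weyl part. Only the planes spanned by x4 with x2 or x3 contribute.\<close>

definition coord_curvature :: "real^4 \<Rightarrow> real^4 \<Rightarrow> real^6^6" where
  "coord_curvature x y =
    (let p = 5/6 * (x$4 * y$2 - x$2 * y$4); q = 5/6 * (x$4 * y$3 - x$3 * y$4) in vector
      [vector [0, 0, q, p, 0, 0],
       vector [0, 0, - p, q, 0, 0],
       vector [0, 0, 0, 0, p, - q],
       vector [0, 0, 0, 0, - q, - p],
       vector [0, 0, 0, 0, 0, 0],
       vector [0, 0, 0, 0, 0, 0]])"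

lemma bounded_linear_tractor_of: "bounded_linear tractor_of"
  unfolding linear_conv_bounded_linear[symmetric]
  by (auto simp: tractor_of_def vec_eq_iff forall_6 algebra_simps add_divide_distrib intro!: linearI)

lemma tractor_of_so24: "tractor_of x \<in> so24"
  by (simp add: so24_def tractor_of_def tractor_form_def transpose_def matrix_matrix_mult_def
      vec_eq_iff forall_6 sum_6)

lemma neg_part_tractor_of: "neg_part (tractor_of x) = x"
  by (simp add: neg_part_def tractor_of_def vec_eq_iff forall_4)

lemma mat_bracket_tractor_of:
  "mat_bracket (tractor_of x) (tractor_of y) = tractor_of (coord_bracket x y) + coord_curvature x y"
  unfolding vec_eq_iff forall_6
  by (intro conjI; simp add: mat_bracket_def tractor_of_def coord_bracket_def coord_curvature_def
      Let_def matrix_matrix_mult_def sum_6 field_simps)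

text \<open>The summands for i = 1 and i = 4 vanish and those for i = 2 and i = 3 cancel: the Weyl
  part is trace-free on the x2,x3-plane.\<close>

lemma coord_curvature_normal:
  "(\<Sum>i\<in>UNIV. mat_bracket (pos_elem (axis i 1)) (coord_curvature x (axis i 1))) = 0"
  by (simp add: sum_4 vec_eq_iff forall_6 mat_bracket_def pos_elem_def coord_curvature_def Let_def axis_def
      matrix_matrix_mult_def sum_6 field_simps)

section \<open>Curvature and normality of the connection on the group\<close>

definition gl2_connection :: "gl2 gauge_form" where
  "gl2_connection A V = tractor_of (\<alpha>_minus1 (matrix_inv A ** V))"

lemma soldering_gl2_connection: "soldering gl2_connection A V = \<alpha>_minus1 (matrix_inv A ** V)"
  by (simp add: soldering_def gl2_connection_def neg_part_tractor_of)

lemma bounded_linear_tractor_coords: "bounded_linear (\<lambda>X. tractor_of (\<alpha>_minus1 X))"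
  unfolding \<alpha>_minus1_eq
  by (rule bounded_linear_compose[OF bounded_linear_tractor_of bounded_linear_gl2_coords])

text \<open>Maurer-Cartan equation: the exterior derivative of a left-invariant form contributes
  minus its value on the bracket, so only the defect in \<open>mat_bracket_tractor_of\<close> is
  left.\<close>

lemma curvature_gl2_connection:
  assumes "A \<in> GL2"
  shows "curvature gl2_connection A V W =
    coord_curvature (\<alpha>_minus1 (matrix_inv A ** V)) (\<alpha>_minus1 (matrix_inv A ** W))"
proof -
  let ?a = "\<lambda>X. tractor_of (\<alpha>_minus1 X)" and ?V = "matrix_inv A ** V" and ?W = "matrix_inv A ** W"
  interpret a: bounded_linear ?a
    by (rule bounded_linear_tractor_coords)
  have "((\<lambda>B. gl2_connection B Y) has_derivative (\<lambda>X. ?a (- (matrix_inv A ** X ** matrix_inv A) ** Y))) (at A)" for Y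
    unfolding gl2_connection_def
    by (intro a.has_derivative matrix_inv_has_derivative[OF assms]
        bounded_linear.has_derivative[OF bounded_linear_matrix_mult_left])
  from this[THEN frechet_derivative_eq]
  have "curvature gl2_connection A V W =
      ?a (- (?V ** matrix_inv A) ** W) - ?a (- (?W ** matrix_inv A) ** V) + mat_bracket (?a ?V) (?a ?W)"
    by (simp add: curvature_def gl2_connection_def)
  also have "\<dots> = mat_bracket (?a ?V) (?a ?W) - ?a (mat_bracket ?V ?W)"
    by (simp add: mat_bracket_def a.diff a.neg matrix_mult_linear_simps matrix_mul_assoc)
  also have "?a (mat_bracket ?V ?W) = tractor_of (coord_bracket (\<alpha>_minus1 ?V) (\<alpha>_minus1 ?W))"
    by (simp add: \<alpha>_minus1_eq gl2_coords_mat_bracket)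
  finally show ?thesis
    by (simp add: mat_bracket_tractor_of)
qed

lemma inv_soldering_gl2_connection:
  assumes "A \<in> GL2"
  shows "bij (soldering gl2_connection A)" "inv (soldering gl2_connection A) x = A ** gl2_of x"
proof -
  have *: "A ** gl2_of (soldering gl2_connection A V) = V" "soldering gl2_connection A (A ** gl2_of x) = x" for V x
    by (simp_all add: soldering_gl2_connection \<alpha>_minus1_eq gl2_of_gl2_coords gl2_coords_gl2_of
        matrix_mul_assoc matrix_inv_left matrix_inv_right assms)
  then show "bij (soldering gl2_connection A)"
    by (metis bijI')
  with * show "inv (soldering gl2_connection A) x = A ** gl2_of x"
    by (metis bij_inv_eq_iff)
qed

lemma normal_gl2_connection:
  "normal_conformal_Cartan_connection GL2 (conformal_class GL2 left_invariant_metric) gl2_connection"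
  unfolding normal_conformal_Cartan_connection_def
proof (intro conjI ballI allI)
  show "smooth_on GL2 (\<lambda>A. gl2_connection A V)" for V
    unfolding gl2_connection_def
    by (intro smooth_on_compose_bounded_linear[OF open_GL2 bounded_linear_tractor_coords]
        smooth_on_compose_bounded_linear[OF open_GL2 bounded_linear_matrix_mult_left] smooth_on_matrix_inv)
  show "(\<lambda>x v w. \<nu>_form (soldering gl2_connection x v) (soldering gl2_connection x w))
      \<in> conformal_class GL2 left_invariant_metric"
    unfolding conformal_class_def
    by (auto simp: soldering_gl2_connection left_invariant_metric_def intro: exI[of _ "\<lambda>_. 1"])
next
  fix A :: gl2
  assume A: "A \<in> GL2"
  show "linear (gl2_connection A)"
    unfolding gl2_connection_def[abs_def]
    by (intro bounded_linear.linear bounded_linear_compose[OF bounded_linear_tractor_coords]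
        bounded_linear_matrix_mult_right)
  show "range (gl2_connection A) \<subseteq> so24"
    by (auto simp: gl2_connection_def tractor_of_so24)
  show "bij (soldering gl2_connection A)"
    by (rule inv_soldering_gl2_connection[OF A])
  show "(\<Sum>i\<in>UNIV. mat_bracket (pos_elem (axis i 1))
      (curvature gl2_connection A V (inv (soldering gl2_connection A) (axis i 1)))) = 0" for V
    using A by (simp add: curvature_gl2_connection inv_soldering_gl2_connection matrix_mul_assoc
        matrix_inv_left \<alpha>_minus1_eq gl2_coords_gl2_of coord_curvature_normal)
qed

section \<open>The central field as a normal conformal Killing field\<close>

lemma gl2_coords_mat_1: "gl2_coords (mat 1) = axis 1 (1/2)"
  by (simp add: gl2_coords_def vec_eq_iff forall_4 axis_def mat_def)

lemma coord_curvature_axis_1: "coord_curvature (axis 1 c) x = 0"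
  by (simp add: coord_curvature_def Let_def vec_eq_iff forall_6 axis_def)

lemma tractor_connection_central:
  assumes "A \<in> GL2"
  shows "tractor_connection gl2_connection (\<lambda>A. tractor_of (axis 1 (1/2))) A V = 0"
proof -
  have "coord_bracket x (axis 1 c) = 0" "coord_curvature x (axis 1 c) = 0" for x c
    by (simp_all add: coord_bracket_def coord_curvature_def Let_def vec_eq_iff forall_4 forall_6 axis_def)
  then show ?thesis
    by (simp add: tractor_connection_def gl2_connection_def mat_bracket_tractor_of
        linear_0[OF bounded_linear.linear[OF bounded_linear_tractor_of]])
qed

lemma canonical_prolongation_central:
  "canonical_prolongation GL2 gl2_connection (\<lambda>A. A) (\<lambda>A. tractor_of (axis 1 (1/2)))"
  unfolding canonical_prolongation_def
  by (auto simp: tractor_of_so24 neg_part_tractor_of soldering_gl2_connection matrix_inv_left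
      \<alpha>_minus1_eq gl2_coords_mat_1 tractor_connection_central curvature_gl2_connection
      coord_curvature_axis_1)

text \<open>The metric is homogeneous of degree -2 in the base point; the factor is Euler's formula
  in the direction A.\<close>

lemma left_invariant_metric_has_derivative:
  assumes "A \<in> GL2"
  obtains g' where "((\<lambda>B. left_invariant_metric B V W) has_derivative g') (at A)"
    "g' A = - 2 * left_invariant_metric A V W"
proof -
  let ?c = "\<lambda>B V. gl2_coords (matrix_inv B ** V)"
  let ?c' = "\<lambda>X V. gl2_coords (- (matrix_inv A ** X ** matrix_inv A) ** V)"
  have c: "((\<lambda>B. ?c B V) has_derivative (\<lambda>X. ?c' X V)) (at A)" for V
    by (intro bounded_linear.has_derivative[OF bounded_linear_gl2_coords]
        bounded_linear.has_derivative[OF bounded_linear_matrix_mult_left]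
        matrix_inv_has_derivative[OF assms])
  have "((\<lambda>B. left_invariant_metric B V W) has_derivative
      (\<lambda>X. ?c A V \<bullet> (\<nu> *v ?c' X W) + ?c' X V \<bullet> (\<nu> *v ?c A W))) (at A)"
    unfolding left_invariant_metric_def \<nu>_form_def \<alpha>_minus1_eq
    by (intro has_derivative_inner bounded_linear.has_derivative[OF matrix_vector_mul_bounded_linear] c)
  moreover have "?c' A V = - ?c A V" for V
    by (simp add: matrix_inv_left assms matrix_mult_linear_simps bounded_linear.linear bounded_linear_gl2_coords linear_neg)
  ultimately show ?thesis
    by (intro that[of "\<lambda>X. ?c A V \<bullet> (\<nu> *v ?c' X W) + ?c' X V \<bullet> (\<nu> *v ?c A W)"])
      (auto simp: left_invariant_metric_def \<nu>_form_def \<alpha>_minus1_eq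
        linear_neg[OF matrix_vector_mul_linear])
qed

lemma conformal_Killing_central:
  "conformal_Killing GL2 (conformal_class GL2 left_invariant_metric) (\<lambda>A. A)"
  unfolding conformal_Killing_def
proof (intro conjI ballI)
  show "smooth_on GL2 (\<lambda>A::gl2. A)"
    by (rule smooth_on_bounded_linear) (rule bounded_linear_ident)
next
  fix h
  assume "h \<in> conformal_class GL2 left_invariant_metric"
  then obtain f where f: "smooth_on GL2 f" "\<And>A. A \<in> GL2 \<Longrightarrow> f A > 0"
    "\<And>A V W. A \<in> GL2 \<Longrightarrow> h A V W = f A * left_invariant_metric A V W"
    by (auto simp: conformal_class_def)
  show "\<exists>c. \<forall>A\<in>GL2. \<forall>V W. lie_derivative_metric (\<lambda>A. A) h A V W = c A * h A V W"
  proof (intro exI ballI allI)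
    fix A V W :: gl2
    assume A: "A \<in> GL2"
    let ?f' = "frechet_derivative f (at A)"
    obtain g' where g': "((\<lambda>B. left_invariant_metric B V W) has_derivative g') (at A)"
      "g' A = - 2 * left_invariant_metric A V W"
      by (rule left_invariant_metric_has_derivative[OF A])
    have "frechet_derivative (\<lambda>B. h B V W) (at A) =
        frechet_derivative (\<lambda>B. f B * left_invariant_metric B V W) (at A)"
      using f(3) by (intro frechet_derivative_cong[OF open_GL2 A])
    also have "\<dots> = (\<lambda>X. f A * g' X + ?f' X * left_invariant_metric A V W)"
      by (intro frechet_derivative_eq has_derivative_mult g'
          smooth_on_has_derivative[OF open_GL2 f(1) A])
    finally have h': "frechet_derivative (\<lambda>B. h B V W) (at A) A =
        - 2 * h A V W + ?f' A * left_invariant_metric A V W"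
      using g'(2) f(3)[OF A] by simp
    \<comment> \<open>The derivative of the identity field adds \<open>h A V W\<close> twice and
      cancels the -2; only the variation of the conformal factor survives.\<close>
    have "lie_derivative_metric (\<lambda>A. A) h A V W = ?f' A * left_invariant_metric A V W"
      using h' by (simp add: lie_derivative_metric_def)
    then show "lie_derivative_metric (\<lambda>A. A) h A V W = ?f' A / f A * h A V W"
      using f(2,3)[OF A] by simp
  qed
qed

lemma normal_conformal_Killing_central:
  "normal_conformal_Killing GL2 (conformal_class GL2 left_invariant_metric)
     (left_translation_field (mat 1))"
  unfolding normal_conformal_Killing_def left_translation_field_mat_1
  using conformal_Killing_central normal_gl2_connection canonical_prolongation_central
    tractor_connection_central by blast

section \<open>CR geometries with a global frame\<close>

text \<open>\<open>not_smooth\<close> reflects that tangent vectors are extended by 0.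
  \<open>local\<close> is needed because sections are known only on X, while a bracket applies E to
  functions of the form \<open>\<lambda>p. V p f\<close>.\<close>

locale smooth_derivation =
  fixes X :: "'q set" and C :: "('q \<Rightarrow> real) set" and E :: "'q \<Rightarrow> 'q tvec"
  assumes smooth: "f \<in> C \<Longrightarrow> (\<lambda>q. E q f) \<in> C"
    and not_smooth: "q \<in> X \<Longrightarrow> f \<notin> C \<Longrightarrow> E q f = 0"
    and local: "q \<in> X \<Longrightarrow> (\<And>p. p \<in> X \<Longrightarrow> f p = g p) \<Longrightarrow> E q f = E q g"
    and scale: "q \<in> X \<Longrightarrow> f \<in> C \<Longrightarrow> E q (\<lambda>p. r * f p) = r * E q f"
    and add: "q \<in> X \<Longrightarrow> f \<in> C \<Longrightarrow> g \<in> C \<Longrightarrow> E q (\<lambda>p. f p + g p) = E q f + E q g"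
    and Leibniz: "q \<in> X \<Longrightarrow> f \<in> C \<Longrightarrow> g \<in> C \<Longrightarrow> E q (\<lambda>p. f p * g p) = E q f * g q + f q * E q g"

text \<open>\<open>E1\<close>, \<open>E2\<close> is a global frame of the distribution, and \<open>J E1 = E2\<close>.\<close>

locale contact_frame =
  E1: smooth_derivation X C E1 + E2: smooth_derivation X C E2
  for X :: "'q set" and C E1 E2 +
  fixes T :: "'q \<Rightarrow> 'q tvec set"
  assumes const_smooth: "(\<lambda>q. r) \<in> C"
    and add_smooth: "f \<in> C \<Longrightarrow> g \<in> C \<Longrightarrow> (\<lambda>q. f q + g q) \<in> C"
    and mult_smooth: "f \<in> C \<Longrightarrow> g \<in> C \<Longrightarrow> (\<lambda>q. f q * g q) \<in> C"
    and smooth_cong: "f \<in> C \<Longrightarrow> (\<And>q. q \<in> X \<Longrightarrow> f q = g q) \<Longrightarrow> g \<in> C"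
    and tangent_dim: "q \<in> X \<Longrightarrow> has_dim 3 (T q)"
    and frame_tangent: "q \<in> X \<Longrightarrow> (\<lambda>f. a * E1 q f + b * E2 q f) \<in> T q"
    and frame_independent: "q \<in> X \<Longrightarrow>
      (\<lambda>f. a * E1 q f + b * E2 q f + c * field_bracket C E1 E2 q f) = (\<lambda>f. 0) \<Longrightarrow>
      a = 0 \<and> b = 0 \<and> c = 0"
    and section_coefficients: "V \<in> smooth_sections X C (\<lambda>q. {\<lambda>f. a * E1 q f + b * E2 q f | a b. True}) \<Longrightarrow>
      \<exists>a\<in>C. \<exists>b\<in>C. \<forall>q\<in>X. V q = (\<lambda>f. a q * E1 q f + b q * E2 q f)"
begin

section \<open>Frame coefficients, brackets and the complex structure\<close>

definition comb :: "'q \<Rightarrow> real \<Rightarrow> real \<Rightarrow> 'q tvec" where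
  "comb q a b = (\<lambda>f. a * E1 q f + b * E2 q f)"

definition distribution :: "'q \<Rightarrow> 'q tvec set" where
  "distribution q = {comb q a b | a b. True}"

text \<open>The structure acts on derivations, so the coefficients have to be read off from u by
  description; \<open>comb_eq_iff\<close> makes them unique for q in X.\<close>

definition complex_structure :: "'q \<Rightarrow> 'q tvec \<Rightarrow> 'q tvec" where
  "complex_structure q u = (THE w. \<exists>a b. u = comb q a b \<and> w = comb q (- b) a)"

abbreviation sections :: "('q \<Rightarrow> 'q tvec) set" where
  "sections \<equiv> smooth_sections X C distribution"

lemma comb_eq_iff: "q \<in> X \<Longrightarrow> comb q a b = comb q a' b' \<longleftrightarrow> a = a' \<and> b = b'"
proof
  assume "q \<in> X" "comb q a b = comb q a' b'"
  moreover from this(2) have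
    "(\<lambda>f. (a - a') * E1 q f + (b - b') * E2 q f + 0 * field_bracket C E1 E2 q f) = (\<lambda>f. 0)"
    by (auto simp: comb_def fun_eq_iff algebra_simps)
  ultimately show "a = a' \<and> b = b'"
    using frame_independent by fastforce
qed auto

lemma comb_in_distribution [simp]: "comb q a b \<in> distribution q"
  by (auto simp: distribution_def)

lemma complex_structure_comb:
  assumes "q \<in> X"
  shows "complex_structure q (comb q a b) = comb q (- b) a"
  unfolding complex_structure_def
  by (rule the_equality) (auto simp: comb_eq_iff[OF assms])

lemma uminus_smooth: "f \<in> C \<Longrightarrow> (\<lambda>q. - f q) \<in> C"
  using mult_smooth[OF const_smooth[of "- 1"], of f] by simp

lemma E_uminus: "q \<in> X \<Longrightarrow> f \<in> C \<Longrightarrow> E1 q (\<lambda>p. - f p) = - E1 q f"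
    "q \<in> X \<Longrightarrow> f \<in> C \<Longrightarrow> E2 q (\<lambda>p. - f p) = - E2 q f"
  using E1.scale[of q f "- 1"] E2.scale[of q f "- 1"] by simp_all

lemma sectionsI:
  assumes "a \<in> C" "b \<in> C" "\<And>q. q \<in> X \<Longrightarrow> V q = comb q (a q) (b q)"
  shows "V \<in> sections"
  unfolding smooth_sections_def
proof (intro CollectI conjI ballI)
  show "(\<lambda>q. V q f) \<in> C" if "f \<in> C" for f
  proof (rule smooth_cong)
    show "(\<lambda>q. a q * E1 q f + b q * E2 q f) \<in> C"
      using assms that by (intro add_smooth mult_smooth E1.smooth E2.smooth)
  qed (simp add: assms comb_def)
qed (simp add: assms)

lemma sectionsE:
  assumes "V \<in> sections"
  obtains a b where "a \<in> C" "b \<in> C" "\<And>q. q \<in> X \<Longrightarrow> V q = comb q (a q) (b q)"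
  using section_coefficients[of V] assms unfolding distribution_def comb_def by blast

text \<open>Leibniz rule. Modulo the distribution only the determinant
  \<open>a q * d q - b q * c q\<close> remains; it is unchanged when both coefficient pairs are
  rotated by J, which is the source of integrability.\<close>

lemma field_bracket_comb:
  assumes smooth: "a \<in> C" "b \<in> C" "c \<in> C" "d \<in> C" and q: "q \<in> X"
    and V: "\<forall>q\<in>X. V q = comb q (a q) (b q)"
    and W: "\<forall>q\<in>X. W q = comb q (c q) (d q)"
  shows "field_bracket C V W q = (\<lambda>f.
    (a q * E1 q c + b q * E2 q c - c q * E1 q a - d q * E2 q a) * E1 q f
    + (a q * E1 q d + b q * E2 q d - c q * E1 q b - d q * E2 q b) * E2 q f
    + (a q * d q - b q * c q) * field_bracket C E1 E2 q f)"
proof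
  fix f
  show "field_bracket C V W q f =
    (a q * E1 q c + b q * E2 q c - c q * E1 q a - d q * E2 q a) * E1 q f
    + (a q * E1 q d + b q * E2 q d - c q * E1 q b - d q * E2 q b) * E2 q f
    + (a q * d q - b q * c q) * field_bracket C E1 E2 q f"
  proof (cases "f \<in> C")
    case True
    note facts = q smooth True E1.smooth[OF True] E2.smooth[OF True] mult_smooth
    have VW: "E1 q (\<lambda>p. V p f) = E1 q (\<lambda>p. a p * E1 p f + b p * E2 p f)"
      "E2 q (\<lambda>p. V p f) = E2 q (\<lambda>p. a p * E1 p f + b p * E2 p f)"
      "E1 q (\<lambda>p. W p f) = E1 q (\<lambda>p. c p * E1 p f + d p * E2 p f)"
      "E2 q (\<lambda>p. W p f) = E2 q (\<lambda>p. c p * E1 p f + d p * E2 p f)"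
      using q V W by (auto simp: comb_def intro!: E1.local E2.local)
    show ?thesis
      using True by (simp add: field_bracket_def bspec[OF V q] bspec[OF W q] comb_def VW E1.add E2.add E1.Leibniz E2.Leibniz facts)
        (simp add: algebra_simps)
  qed (simp add: field_bracket_def E1.not_smooth E2.not_smooth q)
qed

lemma distribution_dim:
  assumes "q \<in> X"
  shows "has_dim 2 (distribution q)"
  unfolding has_dim_def
proof (intro exI[of _ "\<lambda>i::nat. if i = 0 then E1 q else E2 q"] conjI allI impI)
  have "comb q a b \<in> range (\<lambda>c::nat \<Rightarrow> real. \<lambda>f. \<Sum>i<2. c i * (if i = 0 then E1 q else E2 q) f)" for a b
    by (rule range_eqI[of _ _ "\<lambda>i. if i = 0 then a else b"])
      (simp add: comb_def numeral_2_eq_2)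
  then show "distribution q = range (\<lambda>c::nat \<Rightarrow> real. \<lambda>f. \<Sum>i<2. c i * (if i = 0 then E1 q else E2 q) f)"
    by (auto simp: distribution_def comb_def numeral_2_eq_2)
next
  fix c :: "nat \<Rightarrow> real" and i :: nat
  assume "\<forall>f. (\<Sum>i<2. c i * (if i = 0 then E1 q else E2 q) f) = 0" and i: "i < 2"
  then have "comb q (c 0) (c 1) = comb q 0 0"
    by (simp add: comb_def numeral_2_eq_2)
  then show "c i = 0"
    using i assms by (auto simp: comb_eq_iff less_2_cases_iff)
qed

lemma bracket_not_in_distribution:
  assumes "q \<in> X" "t \<noteq> 0"
  shows "(\<lambda>f. a * E1 q f + b * E2 q f + t * field_bracket C E1 E2 q f) \<notin> distribution q"
proof
  assume "(\<lambda>f. a * E1 q f + b * E2 q f + t * field_bracket C E1 E2 q f) \<in> distribution q"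
  then obtain a' b' where
    "(\<lambda>f. a * E1 q f + b * E2 q f + t * field_bracket C E1 E2 q f) = comb q a' b'"
    by (auto simp: distribution_def)
  then have "(\<lambda>f. (a - a') * E1 q f + (b - b') * E2 q f + t * field_bracket C E1 E2 q f) = (\<lambda>f. 0)"
    by (auto simp: comb_def fun_eq_iff algebra_simps)
  then show False
    using frame_independent[OF assms(1)] assms(2) by blast
qed

theorem CR_geometry3_frame: "CR_geometry3 X C T distribution complex_structure"
  unfolding CR_geometry3_def
proof (intro conjI ballI allI impI)
  fix q assume q: "q \<in> X"
  show "has_dim 3 (T q)" "has_dim 2 (distribution q)" "distribution q \<subseteq> T q"
    using q tangent_dim distribution_dim frame_tangent by (auto simp: distribution_def comb_def)
  show "\<exists>V\<in>sections. V q = u" if "u \<in> distribution q" for u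
  proof -
    obtain a b where "u = comb q a b"
      using \<open>u \<in> distribution q\<close> by (auto simp: distribution_def)
    then show ?thesis
      using sectionsI[OF const_smooth const_smooth, of "\<lambda>q. comb q a b" a b] by auto
  qed
  fix u assume "u \<in> distribution q"
  then obtain a b where u: "u = comb q a b"
    by (auto simp: distribution_def)
  show "complex_structure q u \<in> distribution q"
    "complex_structure q (complex_structure q u) = (\<lambda>f. - u f)"
    using q by (simp_all add: u complex_structure_comb) (simp add: comb_def)
  fix w r s assume "w \<in> distribution q"
  then obtain a' b' where w: "w = comb q a' b'"
    by (auto simp: distribution_def)
  have "(\<lambda>f. r * u f + s * w f) = comb q (r * a + s * a') (r * b + s * b')"
    by (auto simp: u w comb_def algebra_simps)
  then show "complex_structure q (\<lambda>f. r * u f + s * w f) =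
      (\<lambda>f. r * complex_structure q u f + s * complex_structure q w f)"
    using q by (auto simp: u w complex_structure_comb) (auto simp: comb_def algebra_simps)
next
  fix V assume "V \<in> sections"
  then obtain a b where V: "a \<in> C" "b \<in> C" "\<forall>q\<in>X. V q = comb q (a q) (b q)"
    by (rule sectionsE) blast
  let ?JV = "\<lambda>q. complex_structure q (V q)"
  have JV: "\<forall>q\<in>X. ?JV q = comb q (- b q) (a q)"
    using V by (simp add: complex_structure_comb)
  have JV_section: "?JV \<in> sections"
    by (rule sectionsI[OF uminus_smooth[OF V(2)] V(1)]) (rule JV[rule_format])
  then show "?JV \<in> sections" .
  show "\<exists>W\<in>sections. field_bracket C V W q \<notin> distribution q" if "q \<in> X" "V q \<noteq> (\<lambda>f. 0)" for q
  proof (rule bexI[OF _ JV_section])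
    have "a q \<noteq> 0 \<or> b q \<noteq> 0"
      using that V(3) by (auto simp: comb_def)
    \<comment> \<open>For W = J V the determinant is a sum of two squares.\<close>
    then have "a q * a q - b q * - b q \<noteq> 0"
      by (simp add: sum_squares_eq_zero_iff)
    then show "field_bracket C V ?JV q \<notin> distribution q"
      unfolding field_bracket_comb[OF V(1,2) uminus_smooth[OF V(2)] V(1) that(1) V(3) JV]
      by (rule bracket_not_in_distribution[OF that(1)])
  qed
  fix W assume "W \<in> sections"
  then obtain c d where W: "c \<in> C" "d \<in> C" "\<forall>q\<in>X. W q = comb q (c q) (d q)"
    by (rule sectionsE) blast
  let ?JW = "\<lambda>q. complex_structure q (W q)"
  have JW: "\<forall>q\<in>X. ?JW q = comb q (- d q) (c q)"
    using W by (simp add: complex_structure_comb)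
  fix q assume q: "q \<in> X"
  note uminus = uminus_smooth[OF V(2)] uminus_smooth[OF W(2)] E_uminus[OF q V(2)] E_uminus[OF q W(2)]
  \<comment> \<open>The frame coefficients of [V,W] - [JV,JW]; the multiples of the frame bracket
    cancel here, and likewise in [JV,W] + [V,JW], where J turns (u1,u2) into (-u2,u1).\<close>
  let ?u1 = "a q * E1 q c + b q * E2 q c - c q * E1 q a - d q * E2 q a
    - (b q * E1 q d - a q * E2 q d - d q * E1 q b + c q * E2 q b)"
  let ?u2 = "a q * E1 q d + b q * E2 q d - c q * E1 q b - d q * E2 q b
    - (- b q * E1 q c + a q * E2 q c + d q * E1 q a - c q * E2 q a)"
  have U: "(\<lambda>f. field_bracket C V W q f - field_bracket C ?JV ?JW q f) = comb q ?u1 ?u2"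
    unfolding field_bracket_comb[OF V(1,2) W(1,2) q V(3) W(3)]
      field_bracket_comb[OF uminus(1) V(1) uminus(2) W(1) q JV JW]
    by (simp add: comb_def uminus algebra_simps)
  have N: "(\<lambda>f. field_bracket C ?JV W q f + field_bracket C V ?JW q f) = comb q (- ?u2) ?u1"
    unfolding field_bracket_comb[OF uminus(1) V(1) W(1,2) q JV W(3)]
      field_bracket_comb[OF V(1,2) uminus(2) W(1) q V(3) JW]
    by (simp add: comb_def uminus algebra_simps)
  show "let JV = ?JV; JW = ?JW;
      U = (\<lambda>f. field_bracket C V W q f - field_bracket C JV JW q f)
    in U \<in> distribution q \<and>
      complex_structure q U = (\<lambda>f. field_bracket C JV W q f + field_bracket C V JW q f)"
    unfolding Let_def U N using q by (simp add: complex_structure_comb)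
qed

end

section \<open>The quotient by the center\<close>

abbreviation lift :: "(gl2 set \<Rightarrow> real) \<Rightarrow> gl2 \<Rightarrow> real" where
  "lift f \<equiv> \<lambda>A. f (coset_proj A)"

definition quot_rep :: "gl2 set \<Rightarrow> gl2" where
  "quot_rep q = (SOME A. A \<in> GL2 \<and> coset_proj A = q)"

text \<open>A field has to depend on the coset alone, hence the chosen representative; by
  \<open>dproj_scaleR\<close> any other one gives the same vector.\<close>

definition left_inv_field :: "gl2 \<Rightarrow> gl2 set \<Rightarrow> gl2 set tvec" where
  "left_inv_field X q = dproj (quot_rep q) (quot_rep q ** X)"

lemma coset_proj_quot [simp]: "A \<in> GL2 \<Longrightarrow> coset_proj A \<in> quot"
  by (simp add: quot_def)

lemma quotE:
  assumes "q \<in> quot"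
  obtains A where "A \<in> GL2" "q = coset_proj A"
  using assms by (auto simp: quot_def)

lemma quot_rep:
  assumes "q \<in> quot"
  shows "quot_rep q \<in> GL2" "coset_proj (quot_rep q) = q"
proof -
  have "\<exists>A. A \<in> GL2 \<and> coset_proj A = q"
    using assms by (auto simp: quot_def)
  from someI_ex[OF this] show "quot_rep q \<in> GL2" "coset_proj (quot_rep q) = q"
    by (simp_all add: quot_rep_def)
qed

lemma quot_rep_coset_proj:
  assumes "A \<in> GL2"
  obtains c where "0 < c" "quot_rep (coset_proj A) = c *\<^sub>R A"
  using quot_rep(2)[of "coset_proj A"] assms coset_proj_eq_iff coset_proj_quot by metis

lemma coset_proj_scaleR: "0 < c \<Longrightarrow> coset_proj (c *\<^sub>R A) = coset_proj A"
  using coset_proj_eq_iff[of A "c *\<^sub>R A"] by auto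

lemma quot_smooth_iff: "f \<in> quot_smooth \<longleftrightarrow> smooth_on GL2 (lift f)"
  by (simp add: quot_smooth_def)

lemma bounded_linear_GL2_mult:
  "bounded_linear (\<lambda>A::gl2. h ** A)" "bounded_linear (\<lambda>A::gl2. A ** h)"
  by (rule bounded_linear_matrix_mult_right bounded_linear_matrix_mult_left)+

lemma dproj_scaleR:
  assumes "A \<in> GL2" "0 < c"
  shows "dproj (c *\<^sub>R A) (c *\<^sub>R V) = dproj A V"
proof
  fix f :: "gl2 set \<Rightarrow> real"
  have "frechet_derivative (lift f) (at (c *\<^sub>R A)) (c *\<^sub>R V) = frechet_derivative (lift f) (at A) V"
    if "f \<in> quot_smooth"
  proof -
    have "frechet_derivative (\<lambda>B. lift f (c *\<^sub>R B)) (at A) V =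
        frechet_derivative (lift f) (at (c *\<^sub>R A)) (c *\<^sub>R V)"
      using that assms
      by (intro frechet_derivative_compose_linear[OF open_GL2] bounded_linear_scaleR_right scaleR_GL2)
        (auto simp: quot_smooth_iff)
    then show ?thesis
      using assms(2) by (simp add: coset_proj_scaleR)
  qed
  then show "dproj (c *\<^sub>R A) (c *\<^sub>R V) f = dproj A V f"
    by (simp add: dproj_def)
qed

lemma dproj_eq_0:
  assumes "A \<in> GL2"
  shows "dproj A A = (\<lambda>f. 0)"
proof
  fix f :: "gl2 set \<Rightarrow> real"
  have "frechet_derivative (lift f) (at A) A = 0" if "f \<in> quot_smooth"
  proof -
    \<comment> \<open>A curve through A that stays in one coset, since its factor is positive for
      every t.\<close>
    have "((\<lambda>t::real. exp t *\<^sub>R A) has_derivative (\<lambda>h. h *\<^sub>R A)) (at 0)"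
      by (auto intro!: derivative_eq_intros)
    moreover have "(lift f has_derivative frechet_derivative (lift f) (at A)) (at (exp 0 *\<^sub>R A))"
      using that assms by (simp add: quot_smooth_iff smooth_on_has_derivative[OF open_GL2])
    ultimately have "((\<lambda>t::real. lift f (exp t *\<^sub>R A)) has_derivative
        (\<lambda>h. frechet_derivative (lift f) (at A) (h *\<^sub>R A))) (at 0)"
      by (rule has_derivative_compose)
    then have "((\<lambda>t::real. lift f A) has_derivative
        (\<lambda>h. frechet_derivative (lift f) (at A) (h *\<^sub>R A))) (at 0)"
      by (simp add: coset_proj_scaleR)
    then have "(\<lambda>h::real. frechet_derivative (lift f) (at A) (h *\<^sub>R A)) = (\<lambda>h. 0)"
      using has_derivative_unique has_derivative_const by blast
    from fun_cong[OF this, of 1] show ?thesis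
      by simp
  qed
  then show "dproj A A f = 0"
    by (simp add: dproj_def)
qed

lemma left_inv_field_coset_proj:
  assumes "A \<in> GL2"
  shows "left_inv_field X (coset_proj A) = dproj A (A ** X)"
proof -
  obtain c where "0 < c" "quot_rep (coset_proj A) = c *\<^sub>R A"
    using assms by (rule quot_rep_coset_proj)
  then show ?thesis
    by (simp add: left_inv_field_def matrix_mult_linear_simps dproj_scaleR assms)
qed

lemma left_inv_field_apply:
  "A \<in> GL2 \<Longrightarrow> f \<in> quot_smooth \<Longrightarrow>
    left_inv_field X (coset_proj A) f = frechet_derivative (lift f) (at A) (A ** X)"
  by (simp add: left_inv_field_coset_proj dproj_def)

lemma left_inv_field_not_smooth: "f \<notin> quot_smooth \<Longrightarrow> left_inv_field X q f = 0"
  by (simp add: left_inv_field_def dproj_def)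

lemma left_inv_field_linear:
  assumes "q \<in> quot"
  shows "linear (\<lambda>X. left_inv_field X q f)"
proof (cases "f \<in> quot_smooth")
  case True
  obtain A where A: "A \<in> GL2" "q = coset_proj A"
    using assms by (rule quotE)
  have "linear (frechet_derivative (lift f) (at A))"
    using smooth_on_linear_derivative[OF open_GL2 _ A(1)] True by (simp add: quot_smooth_iff)
  from linear_compose[OF bounded_linear.linear[OF bounded_linear_GL2_mult(1)] this]
  show ?thesis
    using A True by (simp add: left_inv_field_apply o_def)
qed (simp add: left_inv_field_not_smooth linear_zero)

lemma left_inv_field_mat_1: "q \<in> quot \<Longrightarrow> left_inv_field (mat 1) q = (\<lambda>f. 0)"
  by (erule quotE) (simp add: left_inv_field_coset_proj dproj_eq_0)

lemma quot_tangent_eq: "q \<in> quot \<Longrightarrow> quot_tangent q = range (\<lambda>X. left_inv_field X q)"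
proof -
  assume q: "q \<in> quot"
  have "dproj A V = left_inv_field (matrix_inv A ** V) (coset_proj A)" if "A \<in> GL2" for A V
    using that by (simp add: left_inv_field_coset_proj matrix_mul_assoc matrix_inv_right)
  then have "quot_tangent q \<subseteq> range (\<lambda>X. left_inv_field X q)"
    unfolding quot_tangent_def by blast
  moreover have "left_inv_field X q \<in> quot_tangent q" for X
    unfolding quot_tangent_def left_inv_field_def using quot_rep[OF q] by blast
  ultimately show ?thesis
    by blast
qed

lemma smooth_on_derivative_left_inv:
  assumes "f \<in> quot_smooth"
  shows "smooth_on GL2 (\<lambda>A. frechet_derivative (lift f) (at A) (A ** X))"
  using assms[unfolded quot_smooth_iff]
  by (rule smooth_on_derivative_along[OF open_GL2 _ smooth_on_bounded_linear[OF bounded_linear_GL2_mult(2)]])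

lemma left_inv_field_smooth:
  assumes "f \<in> quot_smooth"
  shows "(\<lambda>q. left_inv_field X q f) \<in> quot_smooth"
  unfolding quot_smooth_iff
  using smooth_on_cong[OF open_GL2 left_inv_field_apply[OF _ assms]]
    smooth_on_derivative_left_inv[OF assms] by simp

lemma quot_smooth_const: "(\<lambda>q. r) \<in> quot_smooth"
  by (simp add: quot_smooth_iff)

lemma quot_smooth_add: "f \<in> quot_smooth \<Longrightarrow> g \<in> quot_smooth \<Longrightarrow> (\<lambda>q. f q + g q) \<in> quot_smooth"
  by (simp add: quot_smooth_iff smooth_on_add open_GL2)

lemma quot_smooth_mult: "f \<in> quot_smooth \<Longrightarrow> g \<in> quot_smooth \<Longrightarrow> (\<lambda>q. f q * g q) \<in> quot_smooth"
  by (simp add: quot_smooth_iff smooth_on_mult open_GL2)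

lemma quot_smooth_sum: "(\<And>i. i \<in> I \<Longrightarrow> f i \<in> quot_smooth) \<Longrightarrow> (\<lambda>q. \<Sum>i\<in>I. f i q) \<in> quot_smooth"
  by (simp add: quot_smooth_iff smooth_on_sum open_GL2)

lemma quot_smooth_cong:
  "f \<in> quot_smooth \<Longrightarrow> (\<And>q. q \<in> quot \<Longrightarrow> f q = g q) \<Longrightarrow> g \<in> quot_smooth"
  unfolding quot_smooth_iff using smooth_on_cong[OF open_GL2, of "lift f" "lift g"] by simp

lemma smooth_derivation_left_inv_field:
  "smooth_derivation quot quot_smooth (left_inv_field X)"
proof
  show "(\<lambda>q. left_inv_field X q f) \<in> quot_smooth" if "f \<in> quot_smooth" for f
    using that by (rule left_inv_field_smooth)
  show "left_inv_field X q f = 0" if "f \<notin> quot_smooth" for q f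
    using that by (rule left_inv_field_not_smooth)
next
  fix q f g r
  assume "q \<in> quot"
  then obtain A where A: "A \<in> GL2" "q = coset_proj A"
    by (rule quotE)
  note d = smooth_on_has_derivative[OF open_GL2 _ A(1)]
  show "left_inv_field X q f = left_inv_field X q g" if eq: "\<And>p. p \<in> quot \<Longrightarrow> f p = g p"
  proof (cases "f \<in> quot_smooth")
    case True
    moreover from this have "g \<in> quot_smooth"
      using quot_smooth_cong eq by blast
    moreover have "frechet_derivative (lift f) (at A) = frechet_derivative (lift g) (at A)"
      using eq by (intro frechet_derivative_cong[OF open_GL2 A(1)]) simp
    ultimately show ?thesis
      using A by (simp add: left_inv_field_apply)
  next
    case False
    moreover from this have "g \<notin> quot_smooth"
      using quot_smooth_cong eq by metis
    ultimately show ?thesis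
      by (simp add: left_inv_field_not_smooth)
  qed
  assume f: "f \<in> quot_smooth"
  then have df: "(lift f has_derivative frechet_derivative (lift f) (at A)) (at A)"
    by (intro d) (simp add: quot_smooth_iff)
  show "left_inv_field X q (\<lambda>p. r * f p) = r * left_inv_field X q f"
    using A f frechet_derivative_eq[OF has_derivative_mult_right[OF df, of r]]
    by (simp add: left_inv_field_apply quot_smooth_mult quot_smooth_const)
  assume g: "g \<in> quot_smooth"
  then have dg: "(lift g has_derivative frechet_derivative (lift g) (at A)) (at A)"
    by (intro d) (simp add: quot_smooth_iff)
  show "left_inv_field X q (\<lambda>p. f p + g p) = left_inv_field X q f + left_inv_field X q g"
    using A f g frechet_derivative_eq[OF has_derivative_add[OF df dg]]
    by (simp add: left_inv_field_apply quot_smooth_add)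
  show "left_inv_field X q (\<lambda>p. f p * g p) = left_inv_field X q f * g q + f q * left_inv_field X q g"
    using A f g frechet_derivative_eq[OF has_derivative_mult[OF df dg]]
    by (simp add: left_inv_field_apply quot_smooth_mult)
qed

section \<open>Brackets of left-invariant fields\<close>

lemma left_inv_field_left_inv_field:
  assumes "A \<in> GL2" "f \<in> quot_smooth"
  shows "left_inv_field X (coset_proj A) (\<lambda>q. left_inv_field Y q f) =
    frechet_derivative (\<lambda>B. frechet_derivative (lift f) (at B) (A ** Y)) (at A) (A ** X)
    + frechet_derivative (lift f) (at A) (A ** X ** Y)"
proof -
  have "frechet_derivative (\<lambda>B. left_inv_field Y (coset_proj B) f) (at A) =
      frechet_derivative (\<lambda>B. frechet_derivative (lift f) (at B) (B ** Y)) (at A)"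
    by (rule frechet_derivative_cong[OF open_GL2 assms(1) left_inv_field_apply[OF _ assms(2)]])
  then show ?thesis
    using frechet_derivative_derivative_along[OF open_GL2 assms(2)[unfolded quot_smooth_iff]
        smooth_on_bounded_linear[OF bounded_linear_GL2_mult(2)] assms(1), of Y "A ** X"]
      frechet_derivative_eq[OF bounded_linear_imp_has_derivative[OF bounded_linear_GL2_mult(2)], of Y A]
    by (simp add: left_inv_field_apply[OF assms(1) left_inv_field_smooth[OF assms(2)]])
qed

text \<open>The second-order terms of the two iterated derivatives agree by symmetry; the
  first-order terms leave the direction A(XY - YX).\<close>

lemma field_bracket_left_inv_field:
  assumes "q \<in> quot"
  shows "field_bracket quot_smooth (left_inv_field X) (left_inv_field Y) q =
    left_inv_field (mat_bracket X Y) q"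
proof
  fix f
  obtain A where A: "A \<in> GL2" "q = coset_proj A"
    using assms by (rule quotE)
  show "field_bracket quot_smooth (left_inv_field X) (left_inv_field Y) q f =
    left_inv_field (mat_bracket X Y) q f"
  proof (cases "f \<in> quot_smooth")
    case True
    then have f: "smooth_on GL2 (lift f)"
      by (simp add: quot_smooth_iff)
    have "A ** mat_bracket X Y = A ** X ** Y - A ** Y ** X"
      by (simp add: mat_bracket_def matrix_mult_linear_simps matrix_mul_assoc)
    then have "left_inv_field (mat_bracket X Y) q f =
        frechet_derivative (lift f) (at A) (A ** X ** Y) - frechet_derivative (lift f) (at A) (A ** Y ** X)"
      using A True linear_diff[OF smooth_on_linear_derivative[OF open_GL2 f A(1)]]
      by (simp add: left_inv_field_apply)
    then show ?thesis
      using A True second_derivative_symmetric[OF open_GL2 f A(1)]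
      by (simp add: field_bracket_def left_inv_field_left_inv_field)
  qed (simp add: field_bracket_def left_inv_field_not_smooth)
qed

section \<open>Recovering the coefficients of a tangent vector\<close>

text \<open>The matrix entries of \<open>A \<otimes> A\<^sup>-\<^sup>1\<close> are homogeneous of degree 0; they separate the tangent
  vectors of the quotient.\<close>

definition adjoint_entry :: "2 \<Rightarrow> 2 \<Rightarrow> 2 \<Rightarrow> 2 \<Rightarrow> gl2 set \<Rightarrow> real" where
  "adjoint_entry i j k l q = quot_rep q $ i $ j * matrix_inv (quot_rep q) $ k $ l"

lemma adjoint_entry_coset_proj:
  assumes "A \<in> GL2"
  shows "adjoint_entry i j k l (coset_proj A) = A $ i $ j * matrix_inv A $ k $ l"
proof -
  obtain c where "0 < c" "quot_rep (coset_proj A) = c *\<^sub>R A"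
    using assms by (rule quot_rep_coset_proj)
  then show ?thesis
    by (simp add: adjoint_entry_def matrix_inv_scaleR assms)
qed

lemma adjoint_entry_smooth: "adjoint_entry i j k l \<in> quot_smooth"
proof -
  have "smooth_on GL2 (\<lambda>A. A $ i $ j * matrix_inv A $ k $ l)"
    by (rule smooth_on_mult[OF open_GL2 smooth_on_bounded_linear[OF bounded_linear_entry]
          smooth_on_entry[OF open_GL2 smooth_on_matrix_inv]])
  then show ?thesis
    using smooth_on_cong[OF open_GL2 adjoint_entry_coset_proj] by (simp add: quot_smooth_iff)
qed

lemma left_inv_field_adjoint_entry:
  assumes "A \<in> GL2"
  shows "left_inv_field X (coset_proj A) (adjoint_entry i j k l) =
    (A ** X) $ i $ j * matrix_inv A $ k $ l - A $ i $ j * (X ** matrix_inv A) $ k $ l"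
proof -
  have "frechet_derivative (lift (adjoint_entry i j k l)) (at A) =
      frechet_derivative (\<lambda>A. A $ i $ j * matrix_inv A $ k $ l) (at A)"
    by (rule frechet_derivative_cong[OF open_GL2 assms adjoint_entry_coset_proj])
  also have "\<dots> = (\<lambda>V. A $ i $ j * (- (matrix_inv A ** V ** matrix_inv A)) $ k $ l + V $ i $ j * matrix_inv A $ k $ l)"
    by (intro frechet_derivative_eq has_derivative_mult
        bounded_linear.has_derivative[OF bounded_linear_entry] has_derivative_ident
        matrix_inv_has_derivative assms)
  finally show ?thesis
    using assms by (simp add: left_inv_field_apply adjoint_entry_smooth matrix_mul_assoc matrix_inv_left)
qed

text \<open>Contracting with a further pair A and inverse of A moves the derivative of their tensor
  product back to the identity. For the field of X this leaves the entries of X tensor 1 minus 1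
  tensor X, which determine X up to scalars.\<close>

definition tangent_coefficient :: "2 \<Rightarrow> 2 \<Rightarrow> 2 \<Rightarrow> 2 \<Rightarrow> gl2 set \<Rightarrow> gl2 set tvec \<Rightarrow> real" where
  "tangent_coefficient m j k n q v =
    (\<Sum>i\<in>UNIV. \<Sum>l\<in>UNIV. adjoint_entry l n m i q * v (adjoint_entry i j k l))"

lemma tangent_coefficient_left_inv_field:
  assumes "q \<in> quot"
  shows "tangent_coefficient m j k n q (left_inv_field X q) =
    X $ m $ j * (mat 1 :: gl2) $ k $ n - (mat 1 :: gl2) $ m $ j * X $ k $ n"
proof -
  obtain A where A: "A \<in> GL2" "q = coset_proj A"
    using assms by (rule quotE)
  have "tangent_coefficient m j k n q (left_inv_field X q) =
      (matrix_inv A ** (A ** X)) $ m $ j * (matrix_inv A ** A) $ k $ n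
      - (matrix_inv A ** A) $ m $ j * (X ** matrix_inv A ** A) $ k $ n"
    unfolding tangent_coefficient_def A(2) adjoint_entry_coset_proj[OF A(1)]
      left_inv_field_adjoint_entry[OF A(1)]
      matrix_matrix_mult_def[of "matrix_inv A" "A ** X"] matrix_matrix_mult_def[of "matrix_inv A" A]
      matrix_matrix_mult_def[of "X ** matrix_inv A" A]
    by (simp add: sum_2 algebra_simps)
  also have "matrix_inv A ** (A ** X) = X"
    by (simp add: matrix_mul_assoc matrix_inv_left A)
  also have "X ** matrix_inv A ** A = X"
    by (simp add: matrix_inv_left A flip: matrix_mul_assoc)
  finally show ?thesis
    by (simp add: matrix_inv_left A)
qed

lemma tangent_coefficient_smooth:
  assumes "\<And>f. f \<in> quot_smooth \<Longrightarrow> (\<lambda>q. V q f) \<in> quot_smooth"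
  shows "(\<lambda>q. tangent_coefficient m j k n q (V q)) \<in> quot_smooth"
  unfolding tangent_coefficient_def
  by (intro quot_smooth_sum quot_smooth_mult adjoint_entry_smooth assms)

text \<open>The three index choices give both off-diagonal entries and the diagonal difference, so
  the matrix is scalar; the x1-coordinate stays free because it is vertical.\<close>

lemma left_inv_field_eq_0:
  assumes "q \<in> quot" "left_inv_field (gl2_of x) q = (\<lambda>f. 0)"
  shows "x $ 2 = 0 \<and> x $ 3 = 0 \<and> x $ 4 = 0"
proof -
  have 0: "gl2_of x $ m $ j * (mat 1 :: gl2) $ k $ n = (mat 1 :: gl2) $ m $ j * gl2_of x $ k $ n" for m j k n
    using tangent_coefficient_left_inv_field[OF assms(1), of m j k n "gl2_of x"]
    unfolding assms(2) by (simp add: tangent_coefficient_def)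
  show ?thesis
    using 0[of 1 2 1 1] 0[of 2 1 1 1] 0[of 1 1 2 2] by (simp add: gl2_of_def mat_def)
qed

section \<open>Tangent spaces and the contact frame\<close>

lemma left_inv_field_combination:
  assumes "q \<in> quot"
  shows "left_inv_field (gl2_of (vector [a, b, c, d])) q =
    (\<lambda>f. b * left_inv_field (gl2_of (axis 2 1)) q f + c * left_inv_field (gl2_of (axis 3 1)) q f
      + d * left_inv_field (gl2_of (axis 4 1)) q f)"
proof
  fix f
  interpret l: linear "\<lambda>X. left_inv_field X q f"
    by (rule left_inv_field_linear[OF assms])
  have "gl2_of (vector [a, b, c, d]) = (2 * a) *\<^sub>R mat 1 + b *\<^sub>R gl2_of (axis 2 1)
      + c *\<^sub>R gl2_of (axis 3 1) + d *\<^sub>R gl2_of (axis 4 1)"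
    by (simp add: matrix_eq_2 gl2_of_def axis_def mat_def field_simps)
  then show "left_inv_field (gl2_of (vector [a, b, c, d])) q f =
      b * left_inv_field (gl2_of (axis 2 1)) q f + c * left_inv_field (gl2_of (axis 3 1)) q f
      + d * left_inv_field (gl2_of (axis 4 1)) q f"
    by (simp add: l.add l.scale left_inv_field_mat_1[OF assms])
qed

lemma quot_tangent_dim:
  assumes "q \<in> quot"
  shows "has_dim 3 (quot_tangent q)"
proof -
  define b where "b = (\<lambda>i. left_inv_field (gl2_of (axis (if i = (0::nat) then 2 else if i = 1 then 3 else 4) 1)) q)"
  have comb: "(\<Sum>i<3. c i * b i f) = left_inv_field (gl2_of (vector [0, c 0, c 1, c 2])) q f" for c f
    by (simp add: b_def left_inv_field_combination[OF assms] numeral_3_eq_3 numeral_2_eq_2)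
  show ?thesis
    unfolding has_dim_def comb
  proof (intro exI[of _ b] conjI allI impI)
    have "left_inv_field X q \<in> range (\<lambda>c f. \<Sum>i<3. c i * b i f)" for X
    proof -
      obtain x where "X = gl2_of x"
        by (metis gl2_of_gl2_coords)
      moreover have "x = vector [x$1, x$2, x$3, x$4]"
        by (simp add: vec_eq_iff forall_4)
      ultimately have "left_inv_field X q = left_inv_field (gl2_of (vector [x$1, x$2, x$3, x$4])) q"
        by simp
      also have "\<dots> = left_inv_field (gl2_of (vector [0, x$2, x$3, x$4])) q"
        by (simp only: left_inv_field_combination[OF assms])
      finally show ?thesis
        unfolding comb by (intro range_eqI[of _ _ "(!) [x$2, x$3, x$4]"]) (simp add: numeral_2_eq_2)
    qed
    then show "quot_tangent q = range (\<lambda>c f. \<Sum>i<3. c i * b i f)"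
      by (auto simp: quot_tangent_eq[OF assms] comb)
  next
    fix c :: "nat \<Rightarrow> real" and i :: nat
    assume "\<forall>f. (\<Sum>i<3. c i * b i f) = 0" and i: "i < 3"
    then have "left_inv_field (gl2_of (vector [0, c 0, c 1, c 2])) q = (\<lambda>f. 0)"
      by (simp add: comb fun_eq_iff)
    from left_inv_field_eq_0[OF assms this] show "c i = 0"
      using i by (auto simp: numeral_3_eq_3 less_Suc_eq numeral_2_eq_2)
  qed
qed

lemma field_bracket_frame:
  assumes "q \<in> quot"
  shows "field_bracket quot_smooth (left_inv_field (gl2_of (axis 2 1))) (left_inv_field (gl2_of (axis 3 1))) q =
    left_inv_field (gl2_of (vector [1/3, 0, 0, - 2])) q"
proof -
  \<comment> \<open>The entry 1/3 is central and projects to 0; the entry -2 is the transversal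
    component.\<close>
  have "coord_bracket (axis 2 1) (axis 3 1) = vector [1/3, 0, 0, - 2]"
    by (simp add: coord_bracket_def axis_def)
  then show ?thesis
    by (simp add: field_bracket_left_inv_field[OF assms] mat_bracket_gl2_of)
qed

interpretation quot: contact_frame quot quot_smooth "left_inv_field (gl2_of (axis 2 1))"
  "left_inv_field (gl2_of (axis 3 1))" quot_tangent
proof (intro contact_frame.intro smooth_derivation_left_inv_field contact_frame_axioms.intro)
  let ?E1 = "left_inv_field (gl2_of (axis 2 1))" and ?E2 = "left_inv_field (gl2_of (axis 3 1))"
  fix q a b c
  assume q: "q \<in> quot"
  show "(\<lambda>f. a * ?E1 q f + b * ?E2 q f) \<in> quot_tangent q"
    using left_inv_field_combination[OF q, of 0 a b 0]
    by (simp add: quot_tangent_eq[OF q] image_iff) metis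
  assume "(\<lambda>f. a * ?E1 q f + b * ?E2 q f + c * field_bracket quot_smooth ?E1 ?E2 q f) = (\<lambda>f. 0)"
  then have "left_inv_field (gl2_of (vector [0, a, b, - 2 * c])) q = (\<lambda>f. 0)"
    by (simp add: field_bracket_frame[OF q] left_inv_field_combination[OF q] mult.assoc mult.left_commute)
  from left_inv_field_eq_0[OF q this] show "a = 0 \<and> b = 0 \<and> c = 0"
    by simp
next
  let ?E1 = "left_inv_field (gl2_of (axis 2 1))" and ?E2 = "left_inv_field (gl2_of (axis 3 1))"
  fix V
  assume "V \<in> smooth_sections quot quot_smooth (\<lambda>q. {\<lambda>f. a * ?E1 q f + b * ?E2 q f | a b. True})"
  then have V: "\<And>f. f \<in> quot_smooth \<Longrightarrow> (\<lambda>q. V q f) \<in> quot_smooth"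
    "\<And>q. q \<in> quot \<Longrightarrow> \<exists>a b. V q = (\<lambda>f. a * ?E1 q f + b * ?E2 q f)"
    by (auto simp: smooth_sections_def)
  \<comment> \<open>The off-diagonal entries of the underlying matrix; \<open>?a\<close> and
    \<open>?b\<close> are the second and third components of \<open>gl2_coords\<close> in terms of
    them, hence smooth.\<close>
  let ?X12 = "\<lambda>q. tangent_coefficient 1 2 1 1 q (V q)" and ?X21 = "\<lambda>q. tangent_coefficient 2 1 1 1 q (V q)"
  let ?a = "\<lambda>q. (1 / sqrt 3) * (?X12 q + ?X21 q)" and ?b = "\<lambda>q. sqrt 3 * (?X21 q + (- 1) * ?X12 q)"
  have "?a \<in> quot_smooth" "?b \<in> quot_smooth"
    by (intro quot_smooth_mult quot_smooth_add quot_smooth_const tangent_coefficient_smooth V(1);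
        assumption)+
  moreover have "\<forall>q\<in>quot. V q = (\<lambda>f. ?a q * ?E1 q f + ?b q * ?E2 q f)"
  proof
    fix q assume q: "q \<in> quot"
    obtain a b where ab: "V q = (\<lambda>f. a * ?E1 q f + b * ?E2 q f)"
      using V(2)[OF q] by blast
    then have "V q = left_inv_field (gl2_of (vector [0, a, b, 0])) q"
      by (simp add: left_inv_field_combination[OF q])
    then have X: "?X12 q = sqrt 3 / 6 * (3 * a - b)" "?X21 q = sqrt 3 / 6 * (3 * a + b)"
      by (simp_all add: tangent_coefficient_left_inv_field[OF q] mat_def gl2_of_def)
    have "?a q = a" "?b q = b"
      unfolding X by (simp_all add: field_simps sqrt_3_mult)
    then show "V q = (\<lambda>f. ?a q * ?E1 q f + ?b q * ?E2 q f)"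
      using ab by simp
  qed
  ultimately show "\<exists>a\<in>quot_smooth. \<exists>b\<in>quot_smooth. \<forall>q\<in>quot. V q = (\<lambda>f. a q * ?E1 q f + b q * ?E2 q f)"
    by (intro bexI[of _ ?a] bexI[of _ ?b])
qed (use quot_smooth_const quot_smooth_add quot_smooth_mult quot_smooth_cong quot_tangent_dim in blast)+

section \<open>The invariant CR structure and the group action\<close>

lemma CR_vector_eq_comb:
  assumes "A \<in> GL2"
  shows "CR_vector A z = quot.comb (coset_proj A) (Re z) (Im z)"
proof -
  have "CR_vector A z = left_inv_field (gl2_of (vector [0, Re z, Im z, 0])) (coset_proj A)"
    using assms by (simp add: CR_vector_def left_inv_field_coset_proj)
  then show ?thesis
    using assms by (simp add: left_inv_field_combination quot.comb_def)
qed

lemma quot_distribution_eq: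
  assumes "A \<in> GL2"
  shows "quot.distribution (coset_proj A) = range (CR_vector A)"
proof -
  have "quot.comb (coset_proj A) a b = CR_vector A (Complex a b)" for a b
    by (simp add: CR_vector_eq_comb assms)
  then have "quot.distribution (coset_proj A) \<subseteq> range (CR_vector A)"
    by (auto simp: quot.distribution_def)
  then show ?thesis
    by (auto simp: CR_vector_eq_comb assms)
qed

lemma quot_act_coset_proj: "quot_act h (coset_proj A) = coset_proj (h ** A)"
  by (simp add: quot_act_def coset_proj_eq setcompr_eq_image image_image matrix_mult_linear_simps)

lemma SL2_subset_GL2: "SL2 \<subseteq> GL2"
  by (auto simp: SL2_def GL2_iff_det)

text \<open>The equivalence matters since vectors vanish on non-smooth functions: pushing forward
  must preserve that default too. The converse is the same claim for the inverse of h.\<close>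

lemma quot_smooth_quot_act:
  assumes "h \<in> GL2"
  shows "(\<lambda>q. f (quot_act h q)) \<in> quot_smooth \<longleftrightarrow> f \<in> quot_smooth"
proof -
  have "smooth_on GL2 (\<lambda>A. F (k ** A))" if "smooth_on GL2 F" "k \<in> GL2" for F :: "gl2 \<Rightarrow> real" and k
    using that by (intro smooth_on_compose_linear[OF open_GL2 open_GL2 bounded_linear_GL2_mult(1) _ that(1)])
      (simp add: matrix_mult_GL2)
  from this[of "lift f", OF _ assms] this[of "\<lambda>A. lift f (h ** A)", OF _ matrix_inv_GL2[OF assms]]
  show ?thesis
    by (auto simp: quot_smooth_iff quot_act_coset_proj matrix_mul_assoc matrix_inv_right assms)
qed

lemma pushforward_left_inv_field:
  assumes "h \<in> GL2" "q \<in> quot"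
  shows "pushforward (quot_act h) (left_inv_field X q) = left_inv_field X (quot_act h q)"
proof
  fix f :: "gl2 set \<Rightarrow> real"
  obtain A where A: "A \<in> GL2" "q = coset_proj A"
    using assms(2) by (rule quotE)
  show "pushforward (quot_act h) (left_inv_field X q) f = left_inv_field X (quot_act h q) f"
  proof (cases "f \<in> quot_smooth")
    case True
    then have "frechet_derivative (\<lambda>B. lift f (h ** B)) (at A) (A ** X) =
        frechet_derivative (lift f) (at (h ** A)) (h ** (A ** X))"
      using assms(1) A(1)
      by (intro frechet_derivative_compose_linear[OF open_GL2 _ bounded_linear_GL2_mult(1)])
        (simp_all add: quot_smooth_iff matrix_mult_GL2)
    then show ?thesis
      using True assms A by (simp add: pushforward_def left_inv_field_apply quot_smooth_quot_act
          quot_act_coset_proj matrix_mult_GL2 matrix_mul_assoc)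
  next
    case False
    then show ?thesis
      using assms by (simp add: pushforward_def left_inv_field_not_smooth quot_smooth_quot_act)
  qed
qed

lemma pushforward_comb:
  assumes "h \<in> GL2" "q \<in> quot"
  shows "pushforward (quot_act h) (quot.comb q a b) = quot.comb (quot_act h q) a b"
  using fun_cong[OF pushforward_left_inv_field[OF assms]]
  by (simp add: quot.comb_def pushforward_def fun_eq_iff)

lemma quot_act_quot: "h \<in> GL2 \<Longrightarrow> q \<in> quot \<Longrightarrow> quot_act h q \<in> quot"
  by (auto elim!: quotE simp: quot_act_coset_proj matrix_mult_GL2)

lemma CR_invariant_quot:
  "CR_invariant quot quot.distribution quot.complex_structure SL2 quot_act"
  unfolding CR_invariant_def
proof (intro ballI conjI)
  fix h q
  assume "h \<in> SL2" and q: "q \<in> quot"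
  then have h: "h \<in> GL2"
    using SL2_subset_GL2 by blast
  show q': "quot_act h q \<in> quot"
    using h q by (rule quot_act_quot)
  show "quot.distribution (quot_act h q) = pushforward (quot_act h) ` quot.distribution q"
    by (auto simp: quot.distribution_def pushforward_comb[OF h q, symmetric])
  show "quot.complex_structure (quot_act h q) (pushforward (quot_act h) u) =
      pushforward (quot_act h) (quot.complex_structure q u)" if "u \<in> quot.distribution q" for u
    using that by (auto simp: quot.distribution_def pushforward_comb[OF h q]
        quot.complex_structure_comb[OF q] quot.complex_structure_comb[OF q'])
qed

theorem proposition4p8:
  shows "(\<exists>Z. gl2_center = span {Z} \<and>
            normal_conformal_Killing GL2 (conformal_class GL2 left_invariant_metric)
              (left_translation_field Z)) \<and>
         (\<exists>D J. CR_geometry3 quot quot_smooth quot_tangent D J \<and>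
            CR_invariant quot D J SL2 quot_act \<and>
            (\<forall>A\<in>GL2. D (coset_proj A) = range (CR_vector A) \<and>
               (\<forall>z. J (coset_proj A) (CR_vector A z) = CR_vector A (\<i> * z))))"
proof (intro conjI)
  show "\<exists>Z. gl2_center = span {Z} \<and>
      normal_conformal_Killing GL2 (conformal_class GL2 left_invariant_metric) (left_translation_field Z)"
    using gl2_center_eq normal_conformal_Killing_central by blast
  show "\<exists>D J. CR_geometry3 quot quot_smooth quot_tangent D J \<and>
      CR_invariant quot D J SL2 quot_act \<and>
      (\<forall>A\<in>GL2. D (coset_proj A) = range (CR_vector A) \<and>
         (\<forall>z. J (coset_proj A) (CR_vector A z) = CR_vector A (\<i> * z)))"
    \<comment> \<open>Multiplication by i turns (Re z, Im z) into (- Im z, Re z), as does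
      \<open>complex_structure\<close> on frame coefficients.\<close>
    by (intro exI[of _ quot.distribution] exI[of _ quot.complex_structure] conjI
        quot.CR_geometry3_frame CR_invariant_quot ballI allI)
      (simp_all add: quot_distribution_eq CR_vector_eq_comb quot.complex_structure_comb)
qed

end
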